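(* Let $d=1$, suppose the nondegeneracy assumption (N) holds, and assume additionally that $\alpha''_\epsilon(x_* )\neq0$. Then there exist $\delta>0$ and a constant $\Upsilon>0$, independent of $k$, such that for every $k\ge3$ for which $x^{(k-1)},x^{(k)},x^{(k+1)}$ are within distance $\delta$ of $x_*$ (with $x^{(k)}\ne x_*$) and the assumptions (R) and (B) hold, $$\frac{\big|x^{(k+1)}-x_*\big|}{\big|x^{(k)}-x_*\big|\,\max\{\big|x^{(k)}-x_*\big|,\big|x^{(k-1)}-x_*\big|\}}\le\Upsilon .$$ Here (N), (R), (B) are the assumptions stated in the context.
   Context: Setting. $\Omega\subseteq\mathbb{R}$ is nonempty and open ($d=1$), $\underline{\Omega}\subseteq\Omega$ compact and convex with nonempty interior, $f_1,\dots,f_\kappa:\Omega\to\mathbb{R}$ real-analytic, $A_1,\dots,A_\kappa\in\mathbb{C}^{n\times n}$, $A(x)=\sum_j f_j(x)A_j$, $\epsilon>0$. $\sigma_{\min}$ is the smallest singular value (for an $n\times k$ matrix with $k\le n$, the smallest of its $k$ singular values). $\mathcal{B}(c,r)$ is the closed ball (interval in dimension one). For $z=(z_1,z_2)\in\mathbb{R}^2$, $A(x,z)=A(x)-(z_1+\mathrm{i}z_2)I$, $\sigma(x,z)=\sigma_{\min}(A(x,z))$; $\Lambda_\epsilon(x)=\{z_1+\mathrm{i}z_2:\sigma(x,z)\le\epsilon\}$, $\alpha_\epsilon(x)=\max\{\mathrm{Re}(z):z\in\Lambda_\epsilon(x)\}$. For a subspace $\mathcal{V}\subseteq\mathbb{C}^n$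 with orthonormal basis matrix $V$: $A^V(x)=A(x)V$, $A^V(x,z)=A(x)V-(z_1+\mathrm{i}z_2)V$, $\sigma^{\mathcal{V}}(x,z)=\sigma_{\min}(A^V(x,z))$, $\Lambda^{\mathcal{V}}_\epsilon(x)=\{z_1+\mathrm{i}z_2:\sigma^{\mathcal{V}}(x,z)\le\epsilon\}$ and, when nonempty, $\alpha^{\mathcal{V}}_\epsilon(x)=\max\{\mathrm{Re}(z):z\in\Lambda^{\mathcal{V}}_\epsilon(x)\}$. A rightmost point is one of maximal real part. With $y=(z,\mu)$, $\mu\in\mathbb{R}$, the Lagrangians are $\mathcal{L}(x,y)=z_1-\mu(\sigma(x,z)-\epsilon)$ and $\mathcal{L}^{\mathcal{V}}(x,y)=z_1-\mu(\sigma^{\mathcal{V}}(x,z)-\epsilon)$; $\nabla_y,\nabla^2_{yy}$ are gradient and Hessian in $y\in\mathbb{R}^3$. A consistent pair of unit left, right singular vectors $u,v$ of $M$ for a singular value $s$ satisfies $Mv=su$, $u^*M=sv^*$. Algorithm SF. Choose $x^{(1)}_1,\dots,x^{(1)}_\eta\in\underline{\Omega}$; let $z^{(1)}_j$ be a rightmost point of $\Lambda_\epsilon(x^{(1)}_j)$, $v^{(1)}_j$ a right singular vector for $\sigma_{\min}(A(x^{(1)}_j)-z^{(1)}_jI)$, and $\mathcal{V}_1=\mathrm{span}\{v^{(1)}_1,\dots,v^{(1)}_\eta\}$. For $k=2,3,\dots$: $x^{(k)}$ is any global minimizer of $\alpha^{\mathcal{V}_{k-1}}_\epsilon$ over $\underline{\Omega}$,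 $z^{(k)}$ any rightmost point of $\Lambda_\epsilon(x^{(k)})$, $v^{(k)}$ a unit right singular vector for $\sigma_{\min}(A(x^{(k)})-z^{(k)}I)$, and $\mathcal{V}_k=\mathcal{V}_{k-1}+\mathrm{span}\{v^{(k)}\}$, with $V_k$ an orthonormal basis matrix of $\mathcal{V}_k$. Standing assumption: $\Lambda^{\mathcal{V}_1}_\epsilon(x)\neq\emptyset$ for all $x\in\underline{\Omega}$. Standing assumptions on the optimizer. $x_*$ is a global minimizer of $\alpha_\epsilon(x)$ over $x\in\Omega$; $z_*\in\Lambda_\epsilon(x_* )$ satisfies $\mathrm{Re}(z_* )=\alpha_\epsilon(x_* )$; $\mathcal{R}(z_* )=(\mathrm{Re}(z_* ),\mathrm{Im}(z_* ))$; the three consecutive iterates $x^{(k-1)},x^{(k)},x^{(k+1)}$ under consideration are sufficiently close to $x_*$, with closeness threshold independent of $k$. (N) Nondegeneracy: $x_*$ lies in the interior of $\underline{\Omega}$; $z_*$ is the unique point of $\Lambda_\epsilon(x_* )$ with $\mathrm{Re}(z_* )=\alpha_\epsilon(x_* )$; the singular value $\sigma(x_*,\mathcal{R}(z_* ))$ of $A(x_*,\mathcal{R}(z_* ))$ is simple; and $\nabla^2_{yy}\mathcal{L}(x_*,y_* )$ is invertible, where $y_*=(\mathcal{R}(z_* ),\mu_* )$ with $\mu_*\in\mathbb{R}$ the unique value for which $\nabla_y\mathcal{L}(x_*,y_* )=0$. (R) Robust nondegeneracy (for a given constant $\gamma>0$, fixed independently of $k$): $\sigma_{\min}(\nabla^2_{yy}\mathcal{L}(x_*,y_*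 ))\ge\gamma$ and $\sigma_{\min}(\nabla^2_{yy}\mathcal{L}^{\mathcal{V}_k}(x_*,y_* ))\ge\gamma$. The interval $\mathcal{B}(x_*,\nu_x)$. Under (N), (R) and for iterates sufficiently close to $x_*$, there are $\nu_x,\nu_z,\nu_\mu>0$ independent of $k$ with $\mathcal{B}(x_*,\nu_x)\subseteq\underline{\Omega}$ such that: (a) for all $x\in\mathcal{B}(x_*,\nu_x)$, $z\in\mathcal{B}(\mathcal{R}(z_* ),\nu_z)$ the singular values $\sigma(x,z)$ and $\sigma^{\mathcal{V}_k}(x,z)$ are simple, and their first three derivatives are bounded in absolute value by constants independent of $k$; (b) there is a real-analytic $x\mapsto y(x)=(z(x),\mu(x))\in\mathcal{B}(\mathcal{R}(z_* ),\nu_z)\times\mathcal{B}(\mu_*,\nu_\mu)$ on $\mathcal{B}(x_*,\nu_x)$ with $\alpha_\epsilon(x)=z_1(x)$, $\nabla_y\mathcal{L}(x,y(x))=0$, $\sigma_{\min}(\nabla^2_{yy}\mathcal{L}(x,y(x)))\ge\gamma/2$; (c) there is a real-analytic $x\mapsto y^{\mathcal{V}_k}(x)=(z^{\mathcal{V}_k}(x),\mu^{\mathcal{V}_k}(x))$ into the same set on $\mathcal{B}(x_*,\nu_x)$ with $\alpha^{\mathcal{V}_k}_\epsilon(x)=z^{\mathcal{V}_k}_1(x)$, $\nabla_y\mathcal{L}^{\mathcal{V}_k}(x,y^{\mathcal{V}_k}(x))=0$, $\sigma_{\min}(\nabla^2_{yy}\mathcal{L}^{\mathcal{V}_k}(x,y^{\mathcal{V}_k}(x)))\ge\gamma/2$.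 Fix such $\nu_x,\nu_z,\nu_\mu$. Let $u(x),v(x)$ be a consistent pair of unit left, right singular vectors of $A(x,z(x))$ for $\sigma(x,z(x))$, and $u^{V_k}(x),v^{V_k}(x)$ a consistent pair of unit left, right singular vectors of $A^{V_k}(x,z^{\mathcal{V}_k}(x))$ for $\sigma^{\mathcal{V}_k}(x,z^{\mathcal{V}_k}(x))$. Both $u(x)^*v(x)$ and $u^{V_k}(x)^*V_kv^{V_k}(x)$ are real and negative on $\mathcal{B}(x_*,\nu_x)$; let $\underline{\beta}=\max_{x\in\mathcal{B}(x_*,\nu_x)}u(x)^*v(x)<0$. (B) For a given constant $\beta$, fixed independently of $k$, small enough in absolute value and with $\underline{\beta}\le\beta<0$: $\ \beta\ge\max_{x\in\mathcal{B}(x_*,\nu_x)}u^{V_k}(x)^*V_kv^{V_k}(x)$. *)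

theory Defs
  imports "HOL-Analysis.Analysis" "Jordan_Normal_Form.Schur_Decomposition"
begin

unbundle no vec_syntax

text \<open>The singular values of an \<open>n \<times> k\<close> matrix with \<open>k \<le> n\<close> are the \<open>k\<close> nonnegative square
  roots of the eigenvalues of \<open>M\<^sup>* M\<close>, counted with multiplicity. All matrices below have at least
  as many rows as columns and at least one column.\<close>

definition singular_values :: "complex mat \<Rightarrow> real set" where
  "singular_values M = {s. 0 \<le> s \<and> eigenvalue (mat_adjoint M * M) (complex_of_real (s\<^sup>2))}"

definition sigma_min :: "complex mat \<Rightarrow> real" where
  "sigma_min M = Min (singular_values M)"

definition simple_singular_value :: "complex mat \<Rightarrow> real \<Rightarrow> bool" where
  "simple_singular_value M s \<longleftrightarrow> s \<in> singular_values M \<and>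
     Polynomial.order (complex_of_real (s\<^sup>2)) (char_poly (mat_adjoint M * M)) = 1"

definition singular_vectors :: "complex mat \<Rightarrow> real \<Rightarrow> complex vec \<Rightarrow> complex vec \<Rightarrow> bool" where
  "singular_vectors M s u v \<longleftrightarrow> u \<in> carrier_vec (dim_row M) \<and> v \<in> carrier_vec (dim_col M) \<and>
     M *\<^sub>v v = complex_of_real s \<cdot>\<^sub>v u \<and> mat_adjoint M *\<^sub>v u = complex_of_real s \<cdot>\<^sub>v v"

definition right_singular_vector :: "complex mat \<Rightarrow> real \<Rightarrow> complex vec \<Rightarrow> bool" where
  "right_singular_vector M s v \<longleftrightarrow> v \<noteq> 0\<^sub>v (dim_col M) \<and> (\<exists>u. singular_vectors M s u v)"

definition unit_cvec :: "complex vec \<Rightarrow> bool" where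
  "unit_cvec v \<longleftrightarrow> v \<bullet>c v = 1"

text \<open>The condition \<open>u\<^sup>* M = s v\<^sup>*\<close> appears in its conjugate transposed form \<open>M\<^sup>* u = s v\<close>.\<close>

definition consistent_pair :: "complex mat \<Rightarrow> real \<Rightarrow> complex vec \<Rightarrow> complex vec \<Rightarrow> bool" where
  "consistent_pair M s u v \<longleftrightarrow> unit_cvec u \<and> unit_cvec v \<and> singular_vectors M s u v"

definition matrix_family ::
  "nat \<Rightarrow> nat \<Rightarrow> (nat \<Rightarrow> real \<Rightarrow> real) \<Rightarrow> (nat \<Rightarrow> complex mat) \<Rightarrow> real \<Rightarrow> complex mat" where
  "matrix_family n \<kappa> f A x =
     mat n n (\<lambda>(i, j). \<Sum>l = 1..\<kappa>. complex_of_real (f l x) * (A l $$ (i, j)))"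

text \<open>The pair \<open>z = (z\<^sub>1, z\<^sub>2)\<close> is identified with the complex number \<open>z\<^sub>1 + \<i> z\<^sub>2\<close>. The two pencils
  are \<open>A(x, z)\<close> and \<open>A\<^sup>V(x, z)\<close>; the remaining notions are defined for an arbitrary pencil \<open>P\<close> at a
  fixed \<open>x\<close>, so that they apply to the full and to the reduced problem.\<close>

definition full_pencil :: "nat \<Rightarrow> (real \<Rightarrow> complex mat) \<Rightarrow> real \<Rightarrow> complex \<Rightarrow> complex mat" where
  "full_pencil n A x z = A x - z \<cdot>\<^sub>m 1\<^sub>m n"

definition reduced_pencil :: "(real \<Rightarrow> complex mat) \<Rightarrow> complex mat \<Rightarrow> real \<Rightarrow> complex \<Rightarrow> complex mat" where
  "reduced_pencil A V x z = A x * V - z \<cdot>\<^sub>m V"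

definition pseudospectrum :: "real \<Rightarrow> (complex \<Rightarrow> complex mat) \<Rightarrow> complex set" where
  "pseudospectrum \<epsilon> P = {z. sigma_min (P z) \<le> \<epsilon>}"

text \<open>The supremum is a maximum whenever the pseudospectrum is nonempty, as the latter is compact for
  the pencils above (with orthonormal columns of \<open>V\<close>).\<close>

definition pseudo_abscissa :: "real \<Rightarrow> (complex \<Rightarrow> complex mat) \<Rightarrow> real" where
  "pseudo_abscissa \<epsilon> P = Sup (Re ` pseudospectrum \<epsilon> P)"

definition rightmost_point :: "real \<Rightarrow> (complex \<Rightarrow> complex mat) \<Rightarrow> complex \<Rightarrow> bool" where
  "rightmost_point \<epsilon> P z \<longleftrightarrow>
     z \<in> pseudospectrum \<epsilon> P \<and> (\<forall>w\<in>pseudospectrum \<epsilon> P. Re w \<le> Re z)"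

text \<open>A real-analytic function has a convergent power series around every point of \<open>S\<close>. On a
  compact interval this amounts to having a real-analytic extension to an open neighbourhood.\<close>

definition real_analytic_on :: "(real \<Rightarrow> 'a::real_normed_vector) \<Rightarrow> real set \<Rightarrow> bool" where
  "real_analytic_on g S \<longleftrightarrow> (\<forall>c\<in>S. \<exists>r>0. \<exists>a. \<forall>x\<in>S \<inter> ball c r.
     (\<lambda>m. (x - c) ^ m *\<^sub>R a m) sums g x)"

text \<open>Iterated partial derivatives along the directions listed; the last entry of the list is
  differentiated first.\<close>

primrec partials :: "'a::real_normed_vector list \<Rightarrow> ('a \<Rightarrow> real) \<Rightarrow> 'a \<Rightarrow> real" where
  "partials [] F = F"
| "partials (b # bs) F = (\<lambda>p. frechet_derivative (partials bs F) (at p) b)"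

definition three_derivatives_bounded :: "('a::euclidean_space \<Rightarrow> real) \<Rightarrow> 'a set \<Rightarrow> real \<Rightarrow> bool" where
  "three_derivatives_bounded F S C \<longleftrightarrow> (\<forall>p\<in>S. \<forall>bs. set bs \<subseteq> Basis \<longrightarrow>
     (length bs \<le> 2 \<longrightarrow> partials bs F differentiable at p) \<and>
     (1 \<le> length bs \<and> length bs \<le> 3 \<longrightarrow> \<bar>partials bs F p\<bar> \<le> C))"

text \<open>The variable \<open>y = (z\<^sub>1, z\<^sub>2, \<mu>) \<in> \<real>\<^sup>3\<close> is rendered as a pair in \<^typ>\<open>complex \<times> real\<close>.\<close>

definition lagrangian :: "real \<Rightarrow> (complex \<Rightarrow> complex mat) \<Rightarrow> complex \<times> real \<Rightarrow> real" where
  "lagrangian \<epsilon> P y = Re (fst y) - snd y * (sigma_min (P (fst y)) - \<epsilon>)"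

definition gradient_zero :: "(complex \<times> real \<Rightarrow> real) \<Rightarrow> complex \<times> real \<Rightarrow> bool" where
  "gradient_zero L y \<longleftrightarrow> (L has_derivative (\<lambda>_. 0)) (at y)"

definition twice_differentiable_at :: "('a::euclidean_space \<Rightarrow> real) \<Rightarrow> 'a \<Rightarrow> bool" where
  "twice_differentiable_at L y \<longleftrightarrow> (\<forall>\<^sub>F w in nhds y. L differentiable at w) \<and>
     (\<forall>b\<in>Basis. partials [b] L differentiable at y)"

definition y_basis :: "(complex \<times> real) list" where
  "y_basis = [(1, 0), (\<i>, 0), (0, 1)]"

definition hessian :: "(complex \<times> real \<Rightarrow> real) \<Rightarrow> complex \<times> real \<Rightarrow> real mat" where
  "hessian L y = mat 3 3 (\<lambda>(i, j). partials [y_basis ! i, y_basis ! j] L y)"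

definition hessian_sigma_min_ge :: "real \<Rightarrow> (complex \<times> real \<Rightarrow> real) \<Rightarrow> complex \<times> real \<Rightarrow> bool" where
  "hessian_sigma_min_ge \<gamma> L y \<longleftrightarrow> twice_differentiable_at L y \<and>
     \<gamma> \<le> sigma_min (map_mat complex_of_real (hessian L y))"

abbreviation cspan :: "nat \<Rightarrow> complex vec set \<Rightarrow> complex vec set" where
  "cspan n S \<equiv> LinearCombinations.module.span class_ring (module_vec TYPE(complex) n) S"

definition orthonormal_basis_matrix :: "nat \<Rightarrow> complex vec set \<Rightarrow> complex mat \<Rightarrow> bool" where
  "orthonormal_basis_matrix n VV V \<longleftrightarrow> V \<in> carrier_mat n (dim_col V) \<and>
     mat_adjoint V * V = 1\<^sub>m (dim_col V) \<and> cspan n (set (cols V)) = VV"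

text \<open>A run of the algorithm. The initial data are \<open>X1 j\<close>, \<open>Z1 j\<close>, \<open>W1 j\<close> for \<open>1 \<le> j \<le> \<eta>\<close>; the
  iterates \<open>x k\<close>, \<open>z k\<close>, \<open>v k\<close> are meaningful for \<open>k \<ge> 2\<close>, the subspaces \<open>VV k\<close> and
  their orthonormal basis matrices \<open>V k\<close> for \<open>k \<ge> 1\<close>.\<close>

definition subspace_framework ::
  "nat \<Rightarrow> (real \<Rightarrow> complex mat) \<Rightarrow> real \<Rightarrow> real set \<Rightarrow> nat \<Rightarrow>
   (nat \<Rightarrow> real) \<Rightarrow> (nat \<Rightarrow> complex) \<Rightarrow> (nat \<Rightarrow> complex vec) \<Rightarrow>
   (nat \<Rightarrow> real) \<Rightarrow> (nat \<Rightarrow> complex) \<Rightarrow> (nat \<Rightarrow> complex vec) \<Rightarrow>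
   (nat \<Rightarrow> complex vec set) \<Rightarrow> (nat \<Rightarrow> complex mat) \<Rightarrow> bool" where
  "subspace_framework n A \<epsilon> D \<eta> X1 Z1 W1 x z v VV V \<longleftrightarrow>
     1 \<le> \<eta> \<and>
     (\<forall>j\<in>{1..\<eta>}. X1 j \<in> D \<and>
        rightmost_point \<epsilon> (full_pencil n A (X1 j)) (Z1 j) \<and>
        right_singular_vector (full_pencil n A (X1 j) (Z1 j))
          (sigma_min (full_pencil n A (X1 j) (Z1 j))) (W1 j)) \<and>
     VV 1 = cspan n (W1 ` {1..\<eta>}) \<and>
     (\<forall>k\<ge>1. orthonormal_basis_matrix n (VV k) (V k)) \<and>
     (\<forall>k\<ge>2.
        x k \<in> D \<and>
        (\<forall>x'\<in>D. pseudo_abscissa \<epsilon> (reduced_pencil A (V (k - 1)) (x k))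
               \<le> pseudo_abscissa \<epsilon> (reduced_pencil A (V (k - 1)) x')) \<and>
        rightmost_point \<epsilon> (full_pencil n A (x k)) (z k) \<and>
        unit_cvec (v k) \<and>
        right_singular_vector (full_pencil n A (x k) (z k))
          (sigma_min (full_pencil n A (x k) (z k))) (v k) \<and>
        VV k = {a + b | a b. a \<in> VV (k - 1) \<and> b \<in> cspan n {v k}})"

definition iterates_close :: "(nat \<Rightarrow> real) \<Rightarrow> real \<Rightarrow> real \<Rightarrow> nat \<Rightarrow> bool" where
  "iterates_close x xs \<delta> k \<longleftrightarrow> (\<forall>i\<in>{k - 1, k, k + 1}. \<bar>x i - xs\<bar> \<le> \<delta>)"

text \<open>Below \<open>P x\<close> is the pencil of the full problem at \<open>x\<close> and \<open>Q x\<close> that of a reduced problem;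
  \<open>(xs, zs, \<mu>s)\<close> stands for \<open>(x\<^sub>*, z\<^sub>*, \<mu>\<^sub>*)\<close>.\<close>

definition nondegenerate ::
  "real \<Rightarrow> real set \<Rightarrow> (real \<Rightarrow> complex \<Rightarrow> complex mat) \<Rightarrow> real \<Rightarrow> complex \<Rightarrow> real \<Rightarrow> bool" where
  "nondegenerate \<epsilon> D P xs zs \<mu>s \<longleftrightarrow>
     xs \<in> interior D \<and>
     (\<forall>w\<in>pseudospectrum \<epsilon> (P xs). Re w = pseudo_abscissa \<epsilon> (P xs) \<longleftrightarrow> w = zs) \<and>
     simple_singular_value (P xs zs) (sigma_min (P xs zs)) \<and>
     (\<forall>\<mu>. gradient_zero (lagrangian \<epsilon> (P xs)) (zs, \<mu>) \<longleftrightarrow> \<mu> = \<mu>s) \<and>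
     twice_differentiable_at (lagrangian \<epsilon> (P xs)) (zs, \<mu>s) \<and>
     invertible_mat (hessian (lagrangian \<epsilon> (P xs)) (zs, \<mu>s))"

definition robustly_nondegenerate ::
  "real \<Rightarrow> real \<Rightarrow> (real \<Rightarrow> complex \<Rightarrow> complex mat) \<Rightarrow> (real \<Rightarrow> complex \<Rightarrow> complex mat) \<Rightarrow>
   real \<Rightarrow> complex \<Rightarrow> real \<Rightarrow> bool" where
  "robustly_nondegenerate \<gamma> \<epsilon> P Q xs zs \<mu>s \<longleftrightarrow>
     hessian_sigma_min_ge \<gamma> (lagrangian \<epsilon> (P xs)) (zs, \<mu>s) \<and>
     hessian_sigma_min_ge \<gamma> (lagrangian \<epsilon> (Q xs)) (zs, \<mu>s)"

text \<open>The properties of the radii \<open>\<nu>x, \<nu>z, \<nu>\<mu>\<close> for one pencil \<open>P\<close>, with \<open>C\<close> the bound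
  on the derivatives and \<open>y x = (z(x), \<mu>(x))\<close> the analytic branch of rightmost points and multipliers.\<close>

definition analytic_branch ::
  "real \<Rightarrow> real \<Rightarrow> real \<Rightarrow> (real \<Rightarrow> complex \<Rightarrow> complex mat) \<Rightarrow> real \<Rightarrow> complex \<Rightarrow> real \<Rightarrow>
   real \<Rightarrow> real \<Rightarrow> real \<Rightarrow> (real \<Rightarrow> complex \<times> real) \<Rightarrow> bool" where
  "analytic_branch \<gamma> \<epsilon> C P xs zs \<mu>s \<nu>x \<nu>z \<nu>\<mu> y \<longleftrightarrow>
     (\<forall>x\<in>cball xs \<nu>x. \<forall>z\<in>cball zs \<nu>z. simple_singular_value (P x z) (sigma_min (P x z))) \<and>
     three_derivatives_bounded (\<lambda>(x, z). sigma_min (P x z)) (cball xs \<nu>x \<times> cball zs \<nu>z) C \<and>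
     real_analytic_on y (cball xs \<nu>x) \<and>
     (\<forall>x\<in>cball xs \<nu>x.
        y x \<in> cball zs \<nu>z \<times> cball \<mu>s \<nu>\<mu> \<and>
        pseudo_abscissa \<epsilon> (P x) = Re (fst (y x)) \<and>
        gradient_zero (lagrangian \<epsilon> (P x)) (y x) \<and>
        hessian_sigma_min_ge (\<gamma> / 2) (lagrangian \<epsilon> (P x)) (y x))"

definition singular_pair_along ::
  "(real \<Rightarrow> complex \<Rightarrow> complex mat) \<Rightarrow> (real \<Rightarrow> complex \<times> real) \<Rightarrow> real set \<Rightarrow>
   (real \<Rightarrow> complex vec) \<Rightarrow> (real \<Rightarrow> complex vec) \<Rightarrow> bool" where
  "singular_pair_along P y I u v \<longleftrightarrow> (\<forall>x\<in>I. consistent_pair (P x (fst (y x)))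
     (sigma_min (P x (fst (y x)))) (u x) (v x))"

text \<open>Here \<open>b \<bullet>c a\<close> is \<open>a\<^sup>* b\<close>. The products maximized are real along the branches, so
  that the maximum is taken over the real parts.\<close>

definition max_product :: "real set \<Rightarrow> (real \<Rightarrow> complex vec) \<Rightarrow> (real \<Rightarrow> complex vec) \<Rightarrow> real" where
  "max_product I a b = (SUP x\<in>I. Re (b x \<bullet>c a x))"

end

theory Submission
  imports Defs "Jordan_Normal_Form.Spectral_Radius"
begin

text \<open>
  Since \<open>\<sigma>\<^sub>m\<^sub>i\<^sub>n\<close> is the minimum of \<open>\<parallel>M w\<parallel> / \<parallel>w\<parallel>\<close>, restricting to a subspace shrinks the
  pseudospectrum, so the reduced abscissa \<open>\<alpha>V\<close> lies below \<open>\<alpha>\<close>, with equality at the iterates whose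
  singular vectors were put into the subspace. Hence \<open>\<alpha> - \<alpha>V\<close> is minimal at \<open>x\<^sub>k\<close> and
  \<open>x\<^sub>k\<^sub>-\<^sub>1\<close>, and the first derivatives agree there as well; by Rolle the second derivatives agree in
  between. Combined with \<open>\<alpha>'(x\<^sub>*) = 0 = \<alpha>V'(x\<^sub>k\<^sub>+\<^sub>1)\<close>, this makes \<open>x\<^sub>k\<^sub>+\<^sub>1\<close> a
  quasi-Newton step for \<open>\<alpha>'\<close> whose error is controlled by a bound on third derivatives. That bound is
  uniform in \<open>k\<close> because the branch solves \<open>\<nabla>\<^sub>y \<L>(x, y) = 0\<close> with bounded data and a uniformly
  invertible Hessian. If \<open>x\<^sub>k = x\<^sub>k\<^sub>-\<^sub>1\<close>, Rolle is void, but then \<open>x\<^sub>k\<close> minimizes \<open>\<alpha>\<close> itself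
  and \<open>\<alpha>''(x\<^sub>*) \<noteq> 0\<close> forces \<open>x\<^sub>k = x\<^sub>*\<close>.
\<close>

section \<open>Variational characterization of the smallest singular value\<close>


text \<open>The squared Euclidean norm as a real number, so that values can be compared;
  \<open>w \<bullet>c w\<close> itself is complex.\<close>

definition vnsq :: "complex vec \<Rightarrow> real" where
  "vnsq w = (\<Sum>i<dim_vec w. (cmod (w $ i))\<^sup>2)"

lemma cscalar_self: "w \<bullet>c w = complex_of_real (vnsq w)"
  by (simp add: scalar_prod_def vnsq_def complex_norm_square atLeast0LessThan del: of_real_power)

lemma vnsq_nonneg: "0 \<le> vnsq w"
  by (simp add: vnsq_def sum_nonneg)

lemma vnsq_smult: "vnsq (a \<cdot>\<^sub>v w) = (cmod a)\<^sup>2 * vnsq w"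
  by (simp add: vnsq_def norm_mult power_mult_distrib sum_distrib_left)

lemma vnsq_pos:
  assumes "w \<in> carrier_vec n" "w \<noteq> 0\<^sub>v n"
  shows "0 < vnsq w"
proof -
  obtain i where i: "i < n" "w $ i \<noteq> 0"
    using assms by (metis carrier_vecD eq_vecI index_zero_vec)
  then have "0 < (cmod (w $ i))\<^sup>2"
    by simp
  also have "\<dots> \<le> vnsq w"
    unfolding vnsq_def using assms(1) i by (intro member_le_sum) auto
  finally show ?thesis .
qed

section \<open>Adjoints and the Hermitian inner product\<close>

lemma adjoint_dim [simp]:
  "dim_row (mat_adjoint (M :: complex mat)) = dim_col M"
  "dim_col (mat_adjoint (M :: complex mat)) = dim_row M"
  by (simp_all add: mat_adjoint_def)

lemma adjoint_carrier [simp]: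
  "(M :: complex mat) \<in> carrier_mat r c \<Longrightarrow> mat_adjoint M \<in> carrier_mat c r"
  by (intro carrier_matI) auto

lemma gram_carrier:
  "(M :: complex mat) \<in> carrier_mat r c \<Longrightarrow> mat_adjoint M * M \<in> carrier_mat c c"
  by (rule mult_carrier_mat[OF adjoint_carrier])

lemma adjoint_index [simp]:
  "i < dim_col M \<Longrightarrow> j < dim_row M \<Longrightarrow> mat_adjoint M $$ (i, j) = cnj (M $$ (j, i))"
  unfolding mat_adjoint_def by (subst mat_of_rows_index) simp_all

lemma adjoint_cscalar:
  fixes M :: "complex mat"
  assumes M: "M \<in> carrier_mat r c" and w: "w \<in> carrier_vec c" and u: "u \<in> carrier_vec r"
  shows "(M *\<^sub>v w) \<bullet>c u = w \<bullet>c (mat_adjoint M *\<^sub>v u)"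
proof -
  have "(M *\<^sub>v w) \<bullet>c u = (\<Sum>i<r. (\<Sum>j<c. M $$ (i, j) * w $ j) * cnj (u $ i))"
    using assms by (simp add: scalar_prod_def atLeast0LessThan)
  also have "\<dots> = (\<Sum>i<r. \<Sum>j<c. w $ j * cnj (cnj (M $$ (i, j)) * u $ i))"
    by (simp add: sum_distrib_left mult_ac)
  also have "\<dots> = (\<Sum>j<c. \<Sum>i<r. w $ j * cnj (cnj (M $$ (i, j)) * u $ i))"
    by (rule sum.swap)
  also have "\<dots> = (\<Sum>j<c. w $ j * cnj ((mat_adjoint M *\<^sub>v u) $ j))"
  proof (intro sum.cong refl)
    fix j assume "j \<in> {..<c}"
    then have "(mat_adjoint M *\<^sub>v u) $ j = (\<Sum>i<r. cnj (M $$ (i, j)) * u $ i)"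
      using M u carrier_matD[OF adjoint_carrier[OF M]] by (simp add: scalar_prod_def atLeast0LessThan)
    then show "(\<Sum>i<r. w $ j * cnj (cnj (M $$ (i, j)) * u $ i)) = w $ j * cnj ((mat_adjoint M *\<^sub>v u) $ j)"
      by (simp add: sum_distrib_left)
  qed
  also have "\<dots> = w \<bullet>c (mat_adjoint M *\<^sub>v u)"
    using assms adjoint_carrier[OF M] by (simp add: scalar_prod_def atLeast0LessThan)
  finally show ?thesis .
qed

lemma gram_cscalar:
  fixes M :: "complex mat"
  assumes M: "M \<in> carrier_mat r c" and w: "w \<in> carrier_vec c" and u: "u \<in> carrier_vec c"
  shows "(M *\<^sub>v w) \<bullet>c (M *\<^sub>v u) = w \<bullet>c ((mat_adjoint M * M) *\<^sub>v u)"
  using adjoint_cscalar[OF M w, of "M *\<^sub>v u"] M u adjoint_carrier[OF M]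
  by (simp add: assoc_mult_mat_vec[of _ c r _ c])

section \<open>Singular values and the Rayleigh quotient\<close>

lemma singular_value_vector:
  fixes M :: "complex mat"
  assumes M: "M \<in> carrier_mat r c" and s: "s \<in> singular_values M"
  obtains w where "w \<in> carrier_vec c" "w \<noteq> 0\<^sub>v c" "vnsq (M *\<^sub>v w) = s\<^sup>2 * vnsq w"
proof -
  let ?B = "mat_adjoint M * M"
  have B: "?B \<in> carrier_mat c c"
    by (rule gram_carrier[OF M])
  obtain w where w: "w \<in> carrier_vec c" "w \<noteq> 0\<^sub>v c" "?B *\<^sub>v w = complex_of_real (s\<^sup>2) \<cdot>\<^sub>v w"
    using s B unfolding singular_values_def eigenvalue_def eigenvector_def by auto
  have "complex_of_real (vnsq (M *\<^sub>v w)) = w \<bullet>c (complex_of_real (s\<^sup>2) \<cdot>\<^sub>v w)"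
    using gram_cscalar[OF M w(1) w(1)] w(3) by (simp add: cscalar_self)
  also have "\<dots> = complex_of_real (s\<^sup>2 * vnsq w)"
    using w(1) by (simp add: conjugate_smult_vec cscalar_self)
  finally have "vnsq (M *\<^sub>v w) = s\<^sup>2 * vnsq w"
    by (simp only: of_real_eq_iff)
  with w show thesis by (intro that)
qed

text \<open>\<open>sigma_min\<close> is a \<open>Min\<close>, which is meaningful only on a finite
  set. Squaring is injective on nonnegative reals and sends the singular values into the finite
  spectrum of the Gram matrix.\<close>

lemma finite_singular_values:
  fixes M :: "complex mat"
  assumes M: "M \<in> carrier_mat r c"
  shows "finite (singular_values M)"
proof -
  have "finite (spectrum (mat_adjoint M * M))"
    by (rule card_finite_spectrum(1)[OF gram_carrier[OF M]])
  then have "finite ((\<lambda>s. complex_of_real (s\<^sup>2)) ` singular_values M)"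
    by (rule finite_subset[rotated]) (auto simp: singular_values_def spectrum_def)
  moreover have "inj_on (\<lambda>s. complex_of_real (s\<^sup>2)) (singular_values M)"
    by (auto simp: inj_on_def singular_values_def simp del: of_real_power)
  ultimately show ?thesis
    by (rule finite_imageD)
qed

text \<open>The minimum of the Rayleigh quotient is attained by compactness of the unit sphere, realized
  inside the product space \<^typ>\<open>nat \<Rightarrow> complex\<close>.\<close>

lemma rayleigh_minimizer:
  fixes M :: "complex mat"
  assumes M: "M \<in> carrier_mat r c" and c: "1 \<le> c"
  obtains w0 where "w0 \<in> carrier_vec c" "vnsq w0 = 1"
    "\<And>w. w \<in> carrier_vec c \<Longrightarrow> vnsq (M *\<^sub>v w0) * vnsq w \<le> vnsq (M *\<^sub>v w)"
proof -
  define N where "N g = (\<Sum>j<c. (cmod (g j))\<^sup>2)" for g :: "nat \<Rightarrow> complex"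
  define q where "q g = (\<Sum>i<r. (cmod (\<Sum>j<c. M $$ (i, j) * g j))\<^sup>2)" for g :: "nat \<Rightarrow> complex"
  have N: "vnsq (vec c g) = N g" for g
    by (simp add: vnsq_def N_def)
  have q: "vnsq (M *\<^sub>v vec c g) = q g" for g
    using M by (simp add: vnsq_def q_def scalar_prod_def atLeast0LessThan)
  have coord: "continuous_on S (\<lambda>g::nat \<Rightarrow> complex. g j)" for S j
    by (rule continuous_on_subset[OF continuous_on_product_coordinates]) simp
  have contN: "continuous_on S N" for S
    unfolding N_def by (intro continuous_intros coord)
  have contq: "continuous_on S q" for S
    unfolding q_def by (intro continuous_intros coord)
  \<comment> \<open>Coordinates from \<open>c\<close> on are frozen at 0, so \<open>K\<close> is a
    product of compact sets and contains every unit vector of length \<open>c\<close>, extended by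
    zero.\<close>
  define K where "K = (PiE UNIV (\<lambda>j. if j < c then cball (0::complex) 1 else {0}))"
  have "compactin (product_topology (\<lambda>i. euclidean) UNIV) K"
    unfolding K_def by (subst compactin_PiE) auto
  then have "compact K"
    by (simp add: euclidean_product_topology)
  moreover have "closed {g. N g = 1}"
    using continuous_closed_vimage[of "{1}" N] contN[of UNIV]
    by (simp add: vimage_def continuous_on_eq_continuous_at)
  ultimately have comp: "compact (K \<inter> {g. N g = 1})"
    by (rule compact_Int_closed)
  \<comment> \<open>The first standard basis vector shows that the sphere is nonempty; this is where
    \<open>1 \<le> c\<close> enters.\<close>
  have "N (\<lambda>j. if j = 0 then 1 else 0) = 1"
    using c by (simp add: N_def if_distrib[of "\<lambda>x. (cmod x)\<^sup>2"] sum.delta cong: if_cong)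
  then have "(\<lambda>j. if j = 0 then 1 else 0) \<in> K \<inter> {g. N g = 1}"
    using c by (auto simp: K_def)
  then obtain g0 where g0: "g0 \<in> K \<inter> {g. N g = 1}" "\<And>g. g \<in> K \<inter> {g. N g = 1} \<Longrightarrow> q g0 \<le> q g"
    using continuous_attains_inf[OF comp _ contq] by blast
  show thesis
  proof (rule that[of "vec c g0"])
    show "vec c g0 \<in> carrier_vec c" "vnsq (vec c g0) = 1"
      using g0(1) by (auto simp: N)
    fix w :: "complex vec" assume w: "w \<in> carrier_vec c"
    show "vnsq (M *\<^sub>v vec c g0) * vnsq w \<le> vnsq (M *\<^sub>v w)"
    proof (cases "vnsq w = 0")
      case True
      then show ?thesis by (simp add: vnsq_nonneg)
    next
      case False
      then have pos: "0 < vnsq w"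
        using vnsq_nonneg[of w] by linarith
      define a where "a = 1 / sqrt (vnsq w)"
      have a2: "a\<^sup>2 * vnsq w = 1"
        using pos by (simp add: a_def power_divide)
      define g where "g j = (if j < c then complex_of_real a * w $ j else 0)" for j
      have g: "vec c g = complex_of_real a \<cdot>\<^sub>v w"
        using w by (intro eq_vecI) (auto simp: g_def)
      have Ng: "N g = 1"
        unfolding N[symmetric] g vnsq_smult using a2 by simp
      have "cmod (g j) \<le> 1" if "j < c" for j
      proof -
        have "(cmod (g j))\<^sup>2 \<le> N g"
          unfolding N_def using that by (intro member_le_sum) auto
        then show ?thesis
          using Ng by (simp add: power_le_one_iff abs_square_le_1)
      qed
      then have "g \<in> K \<inter> {g. N g = 1}"
        using Ng by (auto simp: K_def g_def)
      then have "q g0 \<le> vnsq (M *\<^sub>v (complex_of_real a \<cdot>\<^sub>v w))"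
        using g0(2)[of g] by (simp flip: q g)
      also have "\<dots> = a\<^sup>2 * vnsq (M *\<^sub>v w)"
        using M w by (simp add: mult_mat_vec[OF M w] vnsq_smult)
      finally have "q g0 * vnsq w \<le> a\<^sup>2 * vnsq (M *\<^sub>v w) * vnsq w"
        using pos by (intro mult_right_mono) auto
      also have "\<dots> = vnsq (M *\<^sub>v w)"
        using a2 by (simp add: mult_ac)
      finally show ?thesis
        by (simp add: q)
    qed
  qed
qed

text \<open>The minimizer \<open>w0\<close> is stationary: moving it along its residual
  \<open>h\<close> changes the comparison with the minimum \<open>m\<close> to first order by a
  multiple of \<open>vnsq h\<close>. Hence \<open>h\<close> vanishes, \<open>w0\<close> is an
  eigenvector of the Gram matrix for \<open>m\<close>, and the singular value is
  \<open>sqrt m\<close>.\<close>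

lemma rayleigh_singular_value:
  fixes M :: "complex mat"
  assumes M: "M \<in> carrier_mat r c" and c: "1 \<le> c"
  obtains s where "s \<in> singular_values M"
    "\<And>w. w \<in> carrier_vec c \<Longrightarrow> s\<^sup>2 * vnsq w \<le> vnsq (M *\<^sub>v w)"
proof -
  obtain w0 where w0: "w0 \<in> carrier_vec c" "vnsq w0 = 1"
    "\<And>w. w \<in> carrier_vec c \<Longrightarrow> vnsq (M *\<^sub>v w0) * vnsq w \<le> vnsq (M *\<^sub>v w)"
    using rayleigh_minimizer[OF M c] by blast
  define m where "m = vnsq (M *\<^sub>v w0)"
  let ?B = "mat_adjoint M * M"
  have B: "?B \<in> carrier_mat c c"
    by (rule gram_carrier[OF M])
  define h where "h = ?B *\<^sub>v w0 - complex_of_real m \<cdot>\<^sub>v w0"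
  have h: "h \<in> carrier_vec c"
    using B w0(1) by (auto simp: h_def)
  have Bw0: "?B *\<^sub>v w0 = h + complex_of_real m \<cdot>\<^sub>v w0"
    using carrier_matD[OF B] w0(1) by (intro eq_vecI) (simp_all add: h_def del: index_mult_mat)
  define b where "b = vnsq (M *\<^sub>v h) - m * vnsq h"
  \<comment> \<open>The right side is the squared norm of \<open>M w\<close> minus \<open>m\<close>
    times that of \<open>w\<close>, at \<open>w = w0 + t h\<close>. The constant term vanishes by
    the choice of \<open>m\<close>, and the linear coefficient is twice the inner product of
    \<open>h\<close> with itself.\<close>
  have ineq: "0 \<le> 2 * t * vnsq h + t\<^sup>2 * b" for t :: real
  proof -
    let ?t = "complex_of_real t"
    define w where "w = w0 + ?t \<cdot>\<^sub>v h"
    have w: "w \<in> carrier_vec c"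
      using h w0(1) by (auto simp: w_def)
    have expand: "vnsq (p + ?t \<cdot>\<^sub>v k) = vnsq p + 2 * t * Re (k \<bullet>c p) + t\<^sup>2 * vnsq k"
      if "p \<in> carrier_vec d" "k \<in> carrier_vec d" for p k :: "complex vec" and d
    proof -
      have "(cmod (a + ?t * e))\<^sup>2 = (cmod a)\<^sup>2 + 2 * t * Re (e * cnj a) + t\<^sup>2 * (cmod e)\<^sup>2" for a e
        unfolding cmod_power2 by (simp add: power2_eq_square algebra_simps)
      then show ?thesis
        using that
        by (simp add: vnsq_def scalar_prod_def atLeast0LessThan sum.distrib sum_distrib_left distrib_left)
    qed
    have "m * vnsq w \<le> vnsq (M *\<^sub>v w)"
      using w0(3)[OF w] by (simp add: m_def)
    moreover have "vnsq w = 1 + 2 * t * Re (h \<bullet>c w0) + t\<^sup>2 * vnsq h"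
      unfolding w_def using expand[OF w0(1) h] w0(2) by simp
    moreover have "M *\<^sub>v w = M *\<^sub>v w0 + ?t \<cdot>\<^sub>v (M *\<^sub>v h)"
      unfolding w_def using M w0(1) h
      by (simp add: mult_add_distrib_mat_vec[OF M] mult_mat_vec[OF M])
    moreover have "vnsq (M *\<^sub>v w0 + ?t \<cdot>\<^sub>v (M *\<^sub>v h))
        = m + 2 * t * Re ((M *\<^sub>v h) \<bullet>c (M *\<^sub>v w0)) + t\<^sup>2 * vnsq (M *\<^sub>v h)"
      unfolding m_def using M w0(1) h by (intro expand[of _ r]) auto
    moreover have "Re ((M *\<^sub>v h) \<bullet>c (M *\<^sub>v w0)) = vnsq h + m * Re (h \<bullet>c w0)"
    proof -
      have "(M *\<^sub>v h) \<bullet>c (M *\<^sub>v w0) = h \<bullet>c (h + complex_of_real m \<cdot>\<^sub>v w0)"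
        using gram_cscalar[OF M h w0(1)] Bw0 by simp
      also have "\<dots> = h \<bullet>c h + complex_of_real m * (h \<bullet>c w0)"
        using h w0(1)
        by (simp add: conjugate_add_vec[of _ c] conjugate_smult_vec scalar_prod_add_distrib[of _ c])
      finally show ?thesis
        by (simp add: cscalar_self)
    qed
    ultimately show ?thesis
      by (simp add: b_def algebra_simps)
  qed
  have "vnsq h = 0"
  proof (rule ccontr)
    assume "vnsq h \<noteq> 0"
    then have pos: "0 < vnsq h"
      using vnsq_nonneg[of h] by linarith
    \<comment> \<open>\<open>d\<close> is a positive bound for the quadratic coefficient
      \<open>b\<close>. At \<open>t = - vnsq h / d\<close> the linear term wins and the quadratic
      polynomial becomes negative.\<close>
    define d where "d = \<bar>b\<bar> + 1"
    have d: "0 < d" "b \<le> d"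
      by (auto simp: d_def)
    have "0 \<le> 2 * (- vnsq h / d) * vnsq h + (vnsq h / d)\<^sup>2 * b"
      using ineq[of "- vnsq h / d"] by simp
    also have "\<dots> \<le> 2 * (- vnsq h / d) * vnsq h + (vnsq h / d)\<^sup>2 * d"
      using d by (intro add_left_mono mult_left_mono) auto
    also have "\<dots> = - (vnsq h)\<^sup>2 / d"
      using d by (simp add: field_simps power2_eq_square)
    also have "\<dots> < 0"
      using d pos by simp
    finally show False by simp
  qed
  then have "h = 0\<^sub>v c"
    using vnsq_pos[OF h] by auto
  have ev: "?B *\<^sub>v w0 = complex_of_real m \<cdot>\<^sub>v w0"
    using Bw0 w0(1) \<open>h = 0\<^sub>v c\<close> by simp
  have "w0 \<noteq> 0\<^sub>v c"
    using w0(2) by (auto simp: vnsq_def)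
  have m: "0 \<le> m"
    by (simp add: m_def vnsq_nonneg)
  have "eigenvalue ?B (complex_of_real m)"
    unfolding eigenvalue_def eigenvector_def
    using ev w0(1) carrier_matD[OF M] \<open>w0 \<noteq> 0\<^sub>v c\<close> by (intro exI[of _ w0]) simp
  then have "sqrt m \<in> singular_values M"
    using m by (simp add: singular_values_def del: of_real_power)
  moreover have "(sqrt m)\<^sup>2 * vnsq w \<le> vnsq (M *\<^sub>v w)" if "w \<in> carrier_vec c" for w
    using w0(3)[OF that] m by (simp add: m_def)
  ultimately show thesis
    by (rule that)
qed

lemma sigma_min_in:
  fixes M :: "complex mat"
  assumes "M \<in> carrier_mat r c" "1 \<le> c"
  shows "sigma_min M \<in> singular_values M"
  unfolding sigma_min_def
  using rayleigh_singular_value[OF assms] finite_singular_values[OF assms(1)]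
  by (metis Min_in empty_iff)

lemma sigma_min_nonneg:
  fixes M :: "complex mat"
  assumes "M \<in> carrier_mat r c" "1 \<le> c"
  shows "0 \<le> sigma_min M"
  using sigma_min_in[OF assms] by (simp add: singular_values_def)

text \<open>Some singular value bounds the Rayleigh quotient from below, and the smallest one is at
  most that value.\<close>

lemma sigma_min_rayleigh:
  fixes M :: "complex mat"
  assumes M: "M \<in> carrier_mat r c" and w: "w \<in> carrier_vec c"
  shows "(sigma_min M)\<^sup>2 * vnsq w \<le> vnsq (M *\<^sub>v w)"
proof (cases "1 \<le> c")
  case True
  obtain s where s: "s \<in> singular_values M"
    "\<And>w. w \<in> carrier_vec c \<Longrightarrow> s\<^sup>2 * vnsq w \<le> vnsq (M *\<^sub>v w)"
    using rayleigh_singular_value[OF M True] by metis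
  have "sigma_min M \<le> s"
    unfolding sigma_min_def using s(1) finite_singular_values[OF M] by simp
  then have "(sigma_min M)\<^sup>2 * vnsq w \<le> s\<^sup>2 * vnsq w"
    using sigma_min_nonneg[OF M True] by (intro mult_right_mono power_mono vnsq_nonneg)
  also have "\<dots> \<le> vnsq (M *\<^sub>v w)"
    by (rule s(2)[OF w])
  finally show ?thesis .
next
  \<comment> \<open>Here \<open>w\<close> has no entries, so the left side is 0 whatever the value
    of \<open>sigma_min M\<close>.\<close>
  case False
  then show ?thesis
    using w vnsq_nonneg[of "M *\<^sub>v w"] by (simp add: vnsq_def[of w] not_less_eq_eq)
qed

lemma sigma_min_attained:
  fixes M :: "complex mat"
  assumes M: "M \<in> carrier_mat r c" and c: "1 \<le> c"
  obtains w where "w \<in> carrier_vec c" "w \<noteq> 0\<^sub>v c" "vnsq (M *\<^sub>v w) = (sigma_min M)\<^sup>2 * vnsq w"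
  using singular_value_vector[OF M sigma_min_in[OF M c]] by metis

section \<open>Restriction to the range of an orthonormal basis matrix\<close>

lemma vnsq_isometry:
  assumes V: "V \<in> carrier_mat n m" "mat_adjoint V * V = 1\<^sub>m m" and w: "w \<in> carrier_vec m"
  shows "vnsq (V *\<^sub>v w) = vnsq w"
  using gram_cscalar[OF V(1) w w] V(2) w by (simp add: cscalar_self)

lemma sigma_min_le_of_unit:
  fixes M :: "complex mat"
  assumes M: "M \<in> carrier_mat r c" and w: "w \<in> carrier_vec c" "vnsq w = 1" and s: "0 \<le> s"
    and "vnsq (M *\<^sub>v w) \<le> s\<^sup>2"
  shows "sigma_min M \<le> s"
proof (rule power2_le_imp_le[OF _ s])
  have "(sigma_min M)\<^sup>2 * 1 \<le> vnsq (M *\<^sub>v w)"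
    using sigma_min_rayleigh[OF M w(1)] w(2) by simp
  then show "(sigma_min M)\<^sup>2 \<le> s\<^sup>2"
    using assms(5) by simp
qed


text \<open>A larger range means minimizing over more vectors. A minimizing vector for
  \<open>M * V\<close> is rewritten through \<open>V'\<close>; both matrices are isometries, so its
  norm and its image under \<open>M\<close> stay the same.\<close>

lemma sigma_min_mono_range:
  fixes M :: "complex mat"
  assumes M: "M \<in> carrier_mat r n"
    and V: "V \<in> carrier_mat n m" "mat_adjoint V * V = 1\<^sub>m m" and m: "1 \<le> m"
    and V': "V' \<in> carrier_mat n m'" "mat_adjoint V' * V' = 1\<^sub>m m'"
    and range: "\<And>w. w \<in> carrier_vec m \<Longrightarrow> \<exists>w'\<in>carrier_vec m'. V *\<^sub>v w = V' *\<^sub>v w'"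
  shows "sigma_min (M * V') \<le> sigma_min (M * V)"
proof -
  have MV: "M * V \<in> carrier_mat r m" and MV': "M * V' \<in> carrier_mat r m'"
    using M V(1) V'(1) by auto
  obtain w where w: "w \<in> carrier_vec m" "w \<noteq> 0\<^sub>v m"
    "vnsq ((M * V) *\<^sub>v w) = (sigma_min (M * V))\<^sup>2 * vnsq w"
    by (rule sigma_min_attained[OF MV m])
  obtain w' where w': "w' \<in> carrier_vec m'" "V *\<^sub>v w = V' *\<^sub>v w'"
    using range[OF w(1)] by blast
  have "vnsq w' = vnsq w"
    using vnsq_isometry[OF V w(1)] vnsq_isometry[OF V' w'(1)] w'(2) by simp
  moreover have "(M * V') *\<^sub>v w' = (M * V) *\<^sub>v w"
    using M V(1) V'(1) w(1) w' by (simp add: assoc_mult_mat_vec[of _ r n])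
  ultimately have "(sigma_min (M * V'))\<^sup>2 * vnsq w \<le> (sigma_min (M * V))\<^sup>2 * vnsq w"
    using sigma_min_rayleigh[OF MV' w'(1)] w(3) by simp
  then have "(sigma_min (M * V'))\<^sup>2 \<le> (sigma_min (M * V))\<^sup>2"
    using vnsq_pos[OF w(1,2)] by simp
  then show ?thesis
    using sigma_min_nonneg[OF MV m] by (rule power2_le_imp_le)
qed

text \<open>A unit right singular vector for \<open>s\<close> is mapped by \<open>M\<close> to a
  vector of norm \<open>s\<close>. If it lies in the range of \<open>V\<close>, it competes in the
  minimum that defines the restricted smallest singular value.\<close>

lemma sigma_min_right_singular_vector:
  fixes M :: "complex mat"
  assumes M: "M \<in> carrier_mat r n" and V: "V \<in> carrier_mat n m" "mat_adjoint V * V = 1\<^sub>m m"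
    and w: "w \<in> carrier_vec m" "unit_cvec (V *\<^sub>v w)"
    and s: "0 \<le> s" "right_singular_vector M s (V *\<^sub>v w)"
  shows "sigma_min (M * V) \<le> s"
proof (rule sigma_min_le_of_unit[where r = r and c = m and w = w])
  let ?v = "V *\<^sub>v w"
  have v: "?v \<in> carrier_vec n"
    using V(1) w(1) by simp
  have "complex_of_real (vnsq ?v) = complex_of_real 1"
    using w(2) by (simp add: unit_cvec_def cscalar_self)
  then have one: "vnsq ?v = 1"
    by (simp only: of_real_eq_iff)
  then show "vnsq w = 1"
    using vnsq_isometry[OF V w(1)] by simp
  obtain u where u: "u \<in> carrier_vec r" "M *\<^sub>v ?v = complex_of_real s \<cdot>\<^sub>v u"
    "mat_adjoint M *\<^sub>v u = complex_of_real s \<cdot>\<^sub>v ?v"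
    using s(2) M unfolding right_singular_vector_def singular_vectors_def by auto
  have "(mat_adjoint M * M) *\<^sub>v ?v = complex_of_real s \<cdot>\<^sub>v (complex_of_real s \<cdot>\<^sub>v ?v)"
    using u M v adjoint_carrier[OF M]
    by (simp add: assoc_mult_mat_vec[of _ n r _ n] mult_mat_vec[of _ n r])
  then have "complex_of_real (vnsq (M *\<^sub>v ?v)) = complex_of_real (s\<^sup>2)"
    using gram_cscalar[OF M v v] v one
    by (simp add: cscalar_self conjugate_smult_vec power2_eq_square)
  then have "vnsq (M *\<^sub>v ?v) = s\<^sup>2"
    by (simp only: of_real_eq_iff)
  then show "vnsq ((M * V) *\<^sub>v w) \<le> s\<^sup>2"
    using M V(1) w(1) by (simp add: assoc_mult_mat_vec[of _ r n])
qed (use assms in auto)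

section \<open>Spans as column ranges\<close>

lemma cspan_cols:
  assumes V: "V \<in> carrier_mat n m" and a: "a \<in> cspan n (set (cols V))"
  obtains w where "w \<in> carrier_vec m" "a = V *\<^sub>v w"
proof -
  interpret vec_space "TYPE(complex)" n .
  have c: "set (cols V) \<subseteq> carrier_vec n"
    using V cols_dim by blast
  have "a \<in> span_list (cols V)"
    using a span_list_as_span[OF c] by simp
  then obtain l where "a = lincomb_list l (cols V)"
    by (rule in_span_listE)
  also have "\<dots> = mat_of_cols n (cols V) *\<^sub>v vec m l"
    using c V by (subst lincomb_list_as_mat_mult) auto
  also have "mat_of_cols n (cols V) = V"
    using V by (metis carrier_matD(1) mat_of_cols_cols)
  finally show thesis
    by (intro that[of "vec m l"]) auto
qed

lemma mult_in_cspan_cols: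
  assumes V: "V \<in> carrier_mat n m" and w: "w \<in> carrier_vec m"
  shows "V *\<^sub>v w \<in> cspan n (set (cols V))"
proof -
  interpret vec_space "TYPE(complex)" n .
  have c: "\<And>i. i < length (cols V) \<Longrightarrow> cols V ! i \<in> carrier_vec n"
    using V by auto
  have "mat_of_cols n (cols V) *\<^sub>v w \<in> span (set (cols V))"
    using w V c by (subst mat_of_cols_mult_as_finsum) auto
  then show ?thesis
    using V by (metis carrier_matD(1) mat_of_cols_cols)
qed

section \<open>Full and reduced pseudospectra\<close>

lemma full_pencil_carrier:
  "A x \<in> carrier_mat n n \<Longrightarrow> full_pencil n A x z \<in> carrier_mat n n"
  unfolding full_pencil_def by (intro minus_carrier_mat smult_carrier_mat one_carrier_mat)

lemma reduced_pencil_eq: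
  assumes A: "A x \<in> carrier_mat n n" and V: "V \<in> carrier_mat n m"
  shows "reduced_pencil A V x z = full_pencil n A x z * V"
  unfolding reduced_pencil_def full_pencil_def
  using A V by (simp add: minus_mult_distrib_mat[of _ n n _ V m] mult_smult_assoc_mat[of _ n n V m])

text \<open>A Gershgorin argument: row \<open>i\<close> of \<open>M w\<close>, with \<open>i\<close>
  the position of an entry of largest modulus \<open>b\<close> in \<open>w\<close>, isolates
  \<open>z * w $ i\<close>. The factor \<open>sqrt n\<close> in the bound comes from
  \<open>vnsq w \<le> n * b^2\<close>.\<close>

lemma pseudospectrum_bounded:
  assumes A: "A x \<in> carrier_mat n n" and n: "1 \<le> n" and \<epsilon>: "0 < \<epsilon>"
  obtains K where "\<And>z. z \<in> pseudospectrum \<epsilon> (full_pencil n A x) \<Longrightarrow> cmod z \<le> K"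
proof
  let ?K = "(\<Sum>i<n. \<Sum>j<n. cmod (A x $$ (i, j))) + \<epsilon> * sqrt n"
  fix z assume z: "z \<in> pseudospectrum \<epsilon> (full_pencil n A x)"
  define M where "M = full_pencil n A x z"
  have M: "M \<in> carrier_mat n n"
    unfolding M_def by (rule full_pencil_carrier) (rule A)
  obtain w where w: "w \<in> carrier_vec n" "w \<noteq> 0\<^sub>v n" "vnsq (M *\<^sub>v w) = (sigma_min M)\<^sup>2 * vnsq w"
    by (rule sigma_min_attained[OF M n])
  have "sigma_min M \<le> \<epsilon>"
    using z by (simp add: pseudospectrum_def M_def)
  then have le: "vnsq (M *\<^sub>v w) \<le> \<epsilon>\<^sup>2 * vnsq w"
    unfolding w(3) using sigma_min_nonneg[OF M n]
    by (intro mult_right_mono power_mono vnsq_nonneg) auto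
  define b where "b = Max ((\<lambda>i. cmod (w $ i)) ` {..<n})"
  have "b \<in> (\<lambda>i. cmod (w $ i)) ` {..<n}"
    unfolding b_def using n by (intro Max_in) (auto simp: lessThan_empty_iff)
  then obtain i where i: "i < n" "b = cmod (w $ i)"
    by auto
  have max: "cmod (w $ j) \<le> b" if "j < n" for j
    unfolding b_def using that by (intro Max_ge) auto
  have "vnsq w = (\<Sum>j<n. (cmod (w $ j))\<^sup>2)"
    using w(1) by (simp add: vnsq_def)
  also have "\<dots> \<le> (\<Sum>j<n. b\<^sup>2)"
    using max by (intro sum_mono power_mono) auto
  finally have wb: "vnsq w \<le> n * b\<^sup>2"
    by simp
  then have b: "0 < b"
    using vnsq_pos[OF w(1,2)] i(2) by (cases "b = 0") auto
  have "(cmod ((M *\<^sub>v w) $ i))\<^sup>2 \<le> vnsq (M *\<^sub>v w)"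
    unfolding vnsq_def using M w(1) i(1) by (intro member_le_sum) auto
  also have "\<dots> \<le> \<epsilon>\<^sup>2 * (n * b\<^sup>2)"
    using le mult_left_mono[OF wb, of "\<epsilon>\<^sup>2"] by simp
  also have "\<dots> = (\<epsilon> * sqrt n * b)\<^sup>2"
    by (simp add: power_mult_distrib)
  finally have Mw: "cmod ((M *\<^sub>v w) $ i) \<le> \<epsilon> * sqrt n * b"
    by (rule power2_le_imp_le) (use \<epsilon> b in auto)
  have "(M *\<^sub>v w) $ i = (\<Sum>j<n. (A x $$ (i, j) - z * (if i = j then 1 else 0)) * w $ j)"
    using M A w(1) i(1) by (simp add: M_def full_pencil_def scalar_prod_def atLeast0LessThan)
  also have "\<dots> = (\<Sum>j<n. A x $$ (i, j) * w $ j - (if i = j then z * w $ j else 0))"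
    by (intro sum.cong) (auto simp: left_diff_distrib)
  also have "\<dots> = (\<Sum>j<n. A x $$ (i, j) * w $ j) - z * w $ i"
    using i(1) by (simp add: sum_subtractf)
  finally have "z * w $ i = (\<Sum>j<n. A x $$ (i, j) * w $ j) - (M *\<^sub>v w) $ i"
    by simp
  then have "cmod z * b \<le> cmod (\<Sum>j<n. A x $$ (i, j) * w $ j) + cmod ((M *\<^sub>v w) $ i)"
    unfolding i(2) by (metis norm_mult norm_triangle_ineq4)
  also have "cmod (\<Sum>j<n. A x $$ (i, j) * w $ j) \<le> (\<Sum>j<n. cmod (A x $$ (i, j)) * b)"
    using max by (intro sum_norm_le) (auto simp: norm_mult intro: mult_left_mono)
  also have "\<dots> \<le> (\<Sum>i<n. \<Sum>j<n. cmod (A x $$ (i, j)) * b)"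
    using i(1) b by (intro member_le_sum[of i "{..<n}" "\<lambda>i. \<Sum>j<n. cmod (A x $$ (i, j)) * b"])
      (auto intro!: sum_nonneg)
  also note Mw
  finally have "cmod z * b \<le> ?K * b"
    by (simp add: sum_distrib_right distrib_right)
  then show "cmod z \<le> ?K"
    using b by simp
qed

section \<open>Comparison of pseudospectral abscissae\<close>

lemma rightmost_point_abscissa:
  assumes "rightmost_point \<epsilon> P z"
  shows "pseudo_abscissa \<epsilon> P = Re z"
  unfolding pseudo_abscissa_def using assms
  by (intro cSup_eq_maximum) (auto simp: rightmost_point_def)

text \<open>A real \<open>Sup\<close> is an upper bound only for sets bounded above. The subset
  \<open>S\<close> is arbitrary so that both full and reduced pseudospectra are covered.\<close>

lemma Re_le_pseudo_abscissa:
  assumes "A x \<in> carrier_mat n n" "1 \<le> n" "0 < \<epsilon>"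
    and "z \<in> S" "S \<subseteq> pseudospectrum \<epsilon> (full_pencil n A x)"
  shows "Re z \<le> Sup (Re ` S)"
proof -
  obtain K where "\<And>z. z \<in> pseudospectrum \<epsilon> (full_pencil n A x) \<Longrightarrow> cmod z \<le> K"
    using pseudospectrum_bounded[where A = A and x = x, OF assms(1-3)] by blast
  then have "Re z \<le> K" if "z \<in> S" for z
    using that assms(5) complex_Re_le_cmod order_trans by blast
  then show ?thesis
    using assms(4) by (intro cSup_upper) (auto simp: bdd_above_def)
qed

lemma pseudo_abscissa_le_full:
  assumes "A x \<in> carrier_mat n n" "1 \<le> n" "0 < \<epsilon>"
    and "pseudospectrum \<epsilon> P \<noteq> {}" "pseudospectrum \<epsilon> P \<subseteq> pseudospectrum \<epsilon> (full_pencil n A x)"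
  shows "pseudo_abscissa \<epsilon> P \<le> pseudo_abscissa \<epsilon> (full_pencil n A x)"
  unfolding pseudo_abscissa_def
  using assms(4,5) Re_le_pseudo_abscissa[where A = A and x = x, OF assms(1-3) _ order_refl]
  by (intro cSup_least) auto

section \<open>Subspaces along a run of the algorithm\<close>

lemma run_initial_vector:
  assumes "subspace_framework n A \<epsilon> D \<eta> X1 Z1 W1 x z v VV V"
    and A: "\<And>x. A x \<in> carrier_mat n n"
  shows "W1 1 \<in> VV 1" "W1 1 \<noteq> 0\<^sub>v n"
proof -
  interpret vec_space "TYPE(complex)" n .
  have dim: "dim_col (full_pencil n A x z) = n" for x z
    using full_pencil_carrier[where A = A and x = x, OF A] by blast
  have "right_singular_vector (full_pencil n A (X1 j) (Z1 j))
      (sigma_min (full_pencil n A (X1 j) (Z1 j))) (W1 j)" if "j \<in> {1..\<eta>}" for j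
    using assms(1) that unfolding subspace_framework_def by blast
  then have W1: "W1 j \<in> carrier_vec n" "W1 j \<noteq> 0\<^sub>v n" if "j \<in> {1..\<eta>}" for j
    using that unfolding right_singular_vector_def singular_vectors_def dim by blast+
  moreover have "1 \<le> \<eta>" "VV 1 = cspan n (W1 ` {1..\<eta>})"
    using assms(1) unfolding subspace_framework_def by blast+
  then have "1 \<in> {1..\<eta>}" "VV 1 = cspan n (W1 ` {1..\<eta>})"
    by auto
  ultimately show "W1 1 \<noteq> 0\<^sub>v n" "W1 1 \<in> VV 1"
    using in_own_span[of "W1 ` {1..\<eta>}"] by blast+
qed

lemma run_orthonormal:
  assumes "subspace_framework n A \<epsilon> D \<eta> X1 Z1 W1 x z v VV V" "1 \<le> k"
  shows "V k \<in> carrier_mat n (dim_col (V k))" "mat_adjoint (V k) * V k = 1\<^sub>m (dim_col (V k))"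
    "VV k = cspan n (set (cols (V k)))"
  using assms unfolding subspace_framework_def orthonormal_basis_matrix_def by blast+

lemma run_subspace_carrier:
  assumes "subspace_framework n A \<epsilon> D \<eta> X1 Z1 W1 x z v VV V" "1 \<le> k"
  shows "VV k \<subseteq> carrier_vec n"
proof
  fix a assume "a \<in> VV k"
  then obtain w where "w \<in> carrier_vec (dim_col (V k))" "a = V k *\<^sub>v w"
    using run_orthonormal[OF assms] cspan_cols by metis
  then show "a \<in> carrier_vec n"
    using mult_mat_vec_carrier[OF run_orthonormal(1)[OF assms]] by blast
qed

lemma run_subspace_step:
  assumes run: "subspace_framework n A \<epsilon> D \<eta> X1 Z1 W1 x z v VV V"
    and A: "\<And>x. A x \<in> carrier_mat n n" and k: "2 \<le> k"
  shows "VV (k - 1) \<subseteq> VV k" "v k \<in> VV k"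
proof -
  interpret vec_space "TYPE(complex)" n .
  have dim: "dim_col (full_pencil n A x z) = n" for x z
    using full_pencil_carrier[where A = A and x = x, OF A] by blast
  have vk: "v k \<in> carrier_vec n"
    using run k unfolding subspace_framework_def right_singular_vector_def singular_vectors_def dim
    by blast
  have VV: "VV k = {a + b | a b. a \<in> VV (k - 1) \<and> b \<in> cspan n {v k}}"
    using run k unfolding subspace_framework_def by blast
  have prev: "VV (k - 1) \<subseteq> carrier_vec n"
    using k by (intro run_subspace_carrier[OF run]) auto
  have zero: "0\<^sub>v n \<in> cspan n S" for S
    using span_zero[of S] by simp
  show "VV (k - 1) \<subseteq> VV k"
  proof
    fix a assume a: "a \<in> VV (k - 1)"
    then have "a = a + 0\<^sub>v n"
      using prev by auto
    then show "a \<in> VV k"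
      unfolding VV using a zero by blast
  qed
  have "0\<^sub>v n \<in> VV (k - 1)"
    using run_orthonormal(3)[OF run, of "k - 1"] k zero by simp
  moreover have "v k \<in> cspan n {v k}"
    using in_own_span[of "{v k}"] vk by auto
  moreover have "v k = 0\<^sub>v n + v k"
    using vk by simp
  ultimately show "v k \<in> VV k"
    unfolding VV by blast
qed

lemma run_subspace_mono:
  assumes run: "subspace_framework n A \<epsilon> D \<eta> X1 Z1 W1 x z v VV V"
    and A: "\<And>x. A x \<in> carrier_mat n n" and j: "1 \<le> j" and "j \<le> k"
  shows "VV j \<subseteq> VV k"
  using assms(4)
proof (induction k rule: dec_induct)
  case (step k)
  then show ?case
    using run_subspace_step(1)[OF run A, of "Suc k"] j by auto
qed simp

text \<open>The nonzero vector \<open>W1 1\<close> lies in every subspace, while a matrix without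
  columns has only 0 in its range. This secures the existence of singular values for the reduced
  pencils.\<close>

lemma run_dim_pos:
  assumes run: "subspace_framework n A \<epsilon> D \<eta> X1 Z1 W1 x z v VV V"
    and A: "\<And>x. A x \<in> carrier_mat n n" and k: "1 \<le> k"
  shows "1 \<le> dim_col (V k)"
proof (rule ccontr)
  assume "\<not> 1 \<le> dim_col (V k)"
  then have 0: "dim_col (V k) = 0"
    by simp
  have "W1 1 \<in> VV k"
    using run_initial_vector(1)[OF run A] run_subspace_mono[OF run A le_refl k] by blast
  then obtain w where "w \<in> carrier_vec (dim_col (V k))" "W1 1 = V k *\<^sub>v w"
    using run_orthonormal[OF run k] cspan_cols by metis
  then have "W1 1 = 0\<^sub>v n"
    using 0 carrier_matD(1)[OF run_orthonormal(1)[OF run k]]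
    by (intro eq_vecI) (simp_all add: scalar_prod_def)
  then show False
    using run_initial_vector(2)[OF run A] by simp
qed

text \<open>The ranges are nested, so passing to the later one can only lower
  \<open>sigma_min\<close> at each point.\<close>

lemma run_pseudospectrum_mono:
  assumes run: "subspace_framework n A \<epsilon> D \<eta> X1 Z1 W1 x z v VV V"
    and A: "\<And>x. A x \<in> carrier_mat n n" and j: "1 \<le> j" "j \<le> k"
  shows "pseudospectrum \<epsilon> (reduced_pencil A (V j) x') \<subseteq> pseudospectrum \<epsilon> (reduced_pencil A (V k) x')"
proof -
  have k: "1 \<le> k"
    using j by simp
  note Vj = run_orthonormal[OF run j(1)] and Vk = run_orthonormal[OF run k]
  have "sigma_min (reduced_pencil A (V k) x' w) \<le> sigma_min (reduced_pencil A (V j) x' w)" for w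
    unfolding reduced_pencil_eq[OF A Vj(1)] reduced_pencil_eq[OF A Vk(1)]
  proof (rule sigma_min_mono_range[OF full_pencil_carrier Vj(1,2) run_dim_pos[OF run A j(1)] Vk(1,2)])
    fix w :: "complex vec" assume "w \<in> carrier_vec (dim_col (V j))"
    then have "V j *\<^sub>v w \<in> VV k"
      using mult_in_cspan_cols[OF Vj(1)] Vj(3) run_subspace_mono[OF run A j] by blast
    then show "\<exists>w'\<in>carrier_vec (dim_col (V k)). V j *\<^sub>v w = V k *\<^sub>v w'"
      using cspan_cols[OF Vk(1)] Vk(3) by metis
  qed (rule A)
  then show ?thesis
    using order_trans by (fastforce simp: pseudospectrum_def)
qed

text \<open>The identity is an orthonormal basis matrix of the whole space, so the full pencil is
  itself a restricted one and the comparison of ranges applies.\<close>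

lemma run_pseudospectrum_subset_full:
  assumes run: "subspace_framework n A \<epsilon> D \<eta> X1 Z1 W1 x z v VV V"
    and A: "\<And>x. A x \<in> carrier_mat n n" and k: "1 \<le> k"
  shows "pseudospectrum \<epsilon> (reduced_pencil A (V k) x') \<subseteq> pseudospectrum \<epsilon> (full_pencil n A x')"
proof -
  note Vk = run_orthonormal[OF run k]
  have "sigma_min (full_pencil n A x' w) \<le> sigma_min (reduced_pencil A (V k) x' w)" for w
  proof -
    have M: "full_pencil n A x' w \<in> carrier_mat n n"
      by (rule full_pencil_carrier) (rule A)
    have "mat_adjoint (1\<^sub>m n :: complex mat) = 1\<^sub>m n"
      by (intro eq_matI) auto
    then have 1: "mat_adjoint (1\<^sub>m n :: complex mat) * 1\<^sub>m n = 1\<^sub>m n"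
      by simp
    have "sigma_min (full_pencil n A x' w * 1\<^sub>m n) \<le> sigma_min (full_pencil n A x' w * V k)"
    proof (rule sigma_min_mono_range[OF M Vk(1,2) run_dim_pos[OF run A k] one_carrier_mat 1])
      fix w :: "complex vec" assume "w \<in> carrier_vec (dim_col (V k))"
      then show "\<exists>w'\<in>carrier_vec n. V k *\<^sub>v w = 1\<^sub>m n *\<^sub>v w'"
        using mult_mat_vec_carrier[OF Vk(1)] by (intro bexI[of _ "V k *\<^sub>v w"]) simp_all
    qed
    then show ?thesis
      using M by (simp add: reduced_pencil_eq[OF A Vk(1)])
  qed
  then show ?thesis
    using order_trans by (fastforce simp: pseudospectrum_def)
qed

text \<open>The right singular vector of step \<open>j\<close> stays in all later
  subspaces, hence so does the rightmost point it witnesses.\<close>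

lemma run_interpolation:
  assumes run: "subspace_framework n A \<epsilon> D \<eta> X1 Z1 W1 x z v VV V"
    and A: "\<And>x. A x \<in> carrier_mat n n" and n: "1 \<le> n" and j: "2 \<le> j" "j \<le> k"
  shows "z j \<in> pseudospectrum \<epsilon> (reduced_pencil A (V k) (x j))"
proof -
  have k: "1 \<le> k"
    using j by simp
  note Vk = run_orthonormal[OF run k]
  define M where "M = full_pencil n A (x j) (z j)"
  have M: "M \<in> carrier_mat n n"
    unfolding M_def by (rule full_pencil_carrier) (rule A)
  have v: "z j \<in> pseudospectrum \<epsilon> (full_pencil n A (x j))" "unit_cvec (v j)"
    "right_singular_vector M (sigma_min M) (v j)"
    using run j(1) unfolding subspace_framework_def rightmost_point_def M_def by blast+
  have "v j \<in> VV k"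
    using run_subspace_step(2)[OF run A j(1)] run_subspace_mono[OF run A _ j(2)] j by auto
  then obtain w where w: "w \<in> carrier_vec (dim_col (V k))" "v j = V k *\<^sub>v w"
    using cspan_cols[OF Vk(1)] Vk(3) by metis
  have "sigma_min (M * V k) \<le> sigma_min M"
    using v w by (intro sigma_min_right_singular_vector[OF M Vk(1,2) w(1)] sigma_min_nonneg[OF M n]) auto
  also have "\<dots> \<le> \<epsilon>"
    using v(1) by (simp add: pseudospectrum_def M_def)
  finally show ?thesis
    by (simp add: pseudospectrum_def reduced_pencil_eq[OF A Vk(1)] M_def)
qed


section \<open>Real analytic functions of one variable\<close>

lemma real_analytic_on_subset:
  "real_analytic_on g S \<Longrightarrow> T \<subseteq> S \<Longrightarrow> real_analytic_on g T"
  unfolding real_analytic_on_def by (meson Int_iff subsetD)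

lemma real_analytic_on_bounded_linear:
  assumes "bounded_linear h" "real_analytic_on g S"
  shows "real_analytic_on (\<lambda>x. h (g x)) S"
  unfolding real_analytic_on_def
proof
  fix c assume "c \<in> S"
  then obtain r a where r: "0 < r"
    and a: "\<And>x. x \<in> S \<inter> ball c r \<Longrightarrow> (\<lambda>m. (x - c) ^ m *\<^sub>R a m) sums g x"
    using assms(2) unfolding real_analytic_on_def by blast
  have "(\<lambda>m. (x - c) ^ m *\<^sub>R h (a m)) sums h (g x)" if "x \<in> S \<inter> ball c r" for x
    using bounded_linear.sums[OF assms(1) a[OF that]]
    unfolding linear_scale[OF bounded_linear.linear[OF assms(1)]] .
  then show "\<exists>r>0. \<exists>a. \<forall>x\<in>S \<inter> ball c r. (\<lambda>m. (x - c) ^ m *\<^sub>R a m) sums h (g x)"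
    using r by (intro exI[of _ r] conjI exI[of _ "\<lambda>m. h (a m)"] ballI)
qed

text \<open>Power series are differentiated term by term, with coefficients \<open>diffs a\<close>.
  As \<open>S\<close> is open, the ball of convergence can be shrunk into \<open>S\<close>, where
  the series represents \<open>g\<close> on both sides of each point.\<close>

lemma real_analytic_on_deriv:
  fixes g :: "real \<Rightarrow> real"
  assumes S: "open S" and g: "real_analytic_on g S"
  shows "\<And>x. x \<in> S \<Longrightarrow> (g has_real_derivative deriv g x) (at x)" "real_analytic_on (deriv g) S"
proof -
  have local: "\<exists>r>0. \<exists>a. \<forall>x\<in>ball c r.
      (g has_real_derivative deriv g x) (at x) \<and> (\<lambda>m. (x - c) ^ m *\<^sub>R a m) sums deriv g x"
    if c: "c \<in> S" for c
  proof -
    obtain r0 a where r0: "0 < r0" "\<forall>x\<in>S \<inter> ball c r0. (\<lambda>m. (x - c) ^ m *\<^sub>R a m) sums g x"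
      using g c unfolding real_analytic_on_def by blast
    obtain r1 where r1: "0 < r1" "ball c r1 \<subseteq> S"
      using S c open_contains_ball by blast
    define r where "r = min r0 r1"
    have r: "0 < r"
      using r0 r1 by (simp add: r_def)
    have sums: "(\<lambda>m. a m * (x - c) ^ m) sums g x" if "x \<in> ball c r" for x
      using r0(2) r1(2) that by (auto simp: r_def mult.commute)
    have summ: "summable (\<lambda>m. a m * h ^ m)" if "norm h < r" for h
    proof -
      have "c + h \<in> ball c r"
        using that by (simp add: dist_real_def)
      from sums_summable[OF sums[OF this]] show ?thesis
        by simp
    qed
    have der: "(g has_real_derivative (\<Sum>m. diffs a m * (x - c) ^ m)) (at x)" if x: "x \<in> ball c r" for x
    proof -
      have "norm (x - c) < r"
        using x by (simp add: dist_norm norm_minus_commute)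
      from termdiffs_strong'[OF summ this]
      have "((\<lambda>h. \<Sum>m. a m * h ^ m) has_real_derivative (\<Sum>m. diffs a m * (x - c) ^ m)) (at (x - c))" .
      then have "((\<lambda>x. \<Sum>m. a m * (x - c) ^ m) has_real_derivative (\<Sum>m. diffs a m * (x - c) ^ m) * 1) (at x)"
        by (intro DERIV_chain2[where g = "\<lambda>x. x - c"]) (auto intro!: derivative_eq_intros)
      then have "((\<lambda>x. \<Sum>m. a m * (x - c) ^ m) has_real_derivative (\<Sum>m. diffs a m * (x - c) ^ m)) (at x)"
        by simp
      then show ?thesis
      proof (rule has_field_derivative_transform_within_open)
        show "(\<Sum>m. a m * (t - c) ^ m) = g t" if "t \<in> ball c r" for t
          by (rule sums_unique[symmetric]) (rule sums[OF that])
      qed (use x in auto)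
    qed
    have "(\<lambda>m. (x - c) ^ m *\<^sub>R diffs a m) sums deriv g x" if x: "x \<in> ball c r" for x
    proof -
      have "summable (\<lambda>m. diffs a m * (x - c) ^ m)"
        by (rule termdiff_converges[OF _ summ]) (use x in \<open>auto simp: dist_norm norm_minus_commute\<close>)
      then show ?thesis
        using DERIV_imp_deriv[OF der[OF x]] summable_sums by (simp add: mult.commute)
    qed
    moreover have "(g has_real_derivative deriv g x) (at x)" if x: "x \<in> ball c r" for x
      using der[OF x] DERIV_imp_deriv[OF der[OF x]] by simp
    ultimately show ?thesis
      using r by blast
  qed
  then show "real_analytic_on (deriv g) S"
    unfolding real_analytic_on_def by (metis Int_iff)
  show "(g has_real_derivative deriv g x) (at x)" if "x \<in> S" for x
    using local[OF that] by (metis centre_in_ball)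
qed

section \<open>Lower bounds for transposed matrices\<close>

text \<open>Young's inequality with weight \<open>t\<close>, applied to the real and the imaginary
  part of each entry.\<close>

lemma vnsq_am_gm:
  assumes w: "w \<in> carrier_vec n" and u: "u \<in> carrier_vec n" and t: "0 < t"
  shows "2 * Re (w \<bullet>c u) \<le> t * vnsq w + vnsq u / t"
proof -
  have "2 * Re (a * cnj b) \<le> t * (cmod a)\<^sup>2 + (cmod b)\<^sup>2 / t" for a b
  proof -
    have "2 * (p * q) \<le> t * p\<^sup>2 + q\<^sup>2 / t" for p q :: real
    proof -
      have "0 \<le> (t * p - q)\<^sup>2 / t"
        using t by simp
      also have "\<dots> = t * p\<^sup>2 + q\<^sup>2 / t - 2 * (p * q)"
        using t by (simp add: field_simps power2_eq_square)
      finally show ?thesis by simp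
    qed
    from this[of "Re a" "Re b"] this[of "Im a" "Im b"] show ?thesis
      by (simp add: cmod_power2 distrib_left add_divide_distrib)
  qed
  then have "(\<Sum>i<n. 2 * Re (w $ i * cnj (u $ i))) \<le> (\<Sum>i<n. t * (cmod (w $ i))\<^sup>2 + (cmod (u $ i))\<^sup>2 / t)"
    by (intro sum_mono)
  then show ?thesis
    using w u by (simp add: vnsq_def scalar_prod_def atLeast0LessThan sum.distrib sum_distrib_left
      sum_divide_distrib distrib_left)
qed

text \<open>The lower bound makes \<open>M\<close> invertible. Writing \<open>u = M w\<close>, the
  squared norm of \<open>u\<close> is the inner product of \<open>w\<close> with the adjoint applied
  to \<open>u\<close>; Young's inequality with weight \<open>g^2\<close> and
  \<open>g^2 * vnsq w \<le> vnsq u\<close> then absorb half of it.\<close>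

lemma sigma_min_adjoint_rayleigh:
  fixes M :: "complex mat"
  assumes M: "M \<in> carrier_mat n n" and g: "0 < g" "g \<le> sigma_min M" and u: "u \<in> carrier_vec n"
  shows "g\<^sup>2 * vnsq u \<le> vnsq (mat_adjoint M *\<^sub>v u)"
proof -
  have lower: "g\<^sup>2 * vnsq w \<le> vnsq (M *\<^sub>v w)" if "w \<in> carrier_vec n" for w
  proof -
    have "g\<^sup>2 * vnsq w \<le> (sigma_min M)\<^sup>2 * vnsq w"
      using g by (intro mult_right_mono power_mono vnsq_nonneg) auto
    then show ?thesis
      using sigma_min_rayleigh[OF M that] by linarith
  qed
  have "det M \<noteq> 0"
  proof
    assume "det M = 0"
    then obtain w where w: "w \<in> carrier_vec n" "w \<noteq> 0\<^sub>v n" "M *\<^sub>v w = 0\<^sub>v n"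
      using det_0_iff_vec_prod_zero_field[OF M] by blast
    then have "g\<^sup>2 * vnsq w \<le> 0"
      using lower[OF w(1)] by (simp add: vnsq_def)
    moreover have "0 < g\<^sup>2 * vnsq w"
      using vnsq_pos[OF w(1,2)] g by simp
    ultimately show False by simp
  qed
  then obtain N where N: "N \<in> carrier_mat n n" "M * N = 1\<^sub>m n"
    using det_non_zero_imp_unit[OF M] unfolding Units_def ring_mat_def by auto
  define w where "w = N *\<^sub>v u"
  have w: "w \<in> carrier_vec n" "M *\<^sub>v w = u"
    using N u M by (auto simp: w_def simp flip: assoc_mult_mat_vec[of M n n N n u])
  let ?x = "mat_adjoint M *\<^sub>v u"
  have x: "?x \<in> carrier_vec n"
    using mult_mat_vec_carrier[OF adjoint_carrier[OF M] u] .
  have "2 * vnsq u = 2 * Re (w \<bullet>c ?x)"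
    using arg_cong[where f = Re, OF adjoint_cscalar[OF M w(1) u]] w(2) by (simp add: cscalar_self)
  also have "\<dots> \<le> g\<^sup>2 * vnsq w + vnsq ?x / g\<^sup>2"
    using g by (intro vnsq_am_gm[OF w(1) x]) simp
  also have "\<dots> \<le> vnsq u + vnsq ?x / g\<^sup>2"
    using lower[OF w(1)] w(2) by simp
  finally show ?thesis
    using g by (simp add: field_simps)
qed

text \<open>In \<open>partials [b, b']\<close> the direction \<open>b'\<close> is differentiated
  first, so differentiating component \<open>j\<close> of a gradient along a curve with velocity
  \<open>a\<close> produces the sum over \<open>i\<close> of \<open>H $$ (i, j) * a i\<close>. It is
  therefore the transpose that must be bounded from below.\<close>

lemma sigma_min_transpose_bound:
  fixes H :: "real mat"
  assumes H: "H \<in> carrier_mat 3 3" and g: "0 < g" "g \<le> sigma_min (map_mat complex_of_real H)"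
  shows "g\<^sup>2 * (\<Sum>i<3. (a i)\<^sup>2) \<le> (\<Sum>j<3. (\<Sum>i<3. H $$ (i, j) * a i)\<^sup>2)"
proof -
  let ?M = "map_mat complex_of_real H"
  let ?u = "vec 3 (\<lambda>i. complex_of_real (a i))"
  have M: "?M \<in> carrier_mat 3 3"
    using H by simp
  have "(mat_adjoint ?M *\<^sub>v ?u) $ j = complex_of_real (\<Sum>i<3. H $$ (i, j) * a i)" if "j < 3" for j
    using H that by (simp add: scalar_prod_def atLeast0LessThan)
  then have "vnsq (mat_adjoint ?M *\<^sub>v ?u) = (\<Sum>j<3. (\<Sum>i<3. H $$ (i, j) * a i)\<^sup>2)"
    using H by (simp add: vnsq_def del: of_real_sum index_mult_mat_vec)
  moreover have "vnsq ?u = (\<Sum>i<3. (a i)\<^sup>2)"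
    by (simp add: vnsq_def)
  ultimately show ?thesis
    using sigma_min_adjoint_rayleigh[OF M g, of ?u] by simp
qed

section \<open>The quasi-Newton step\<close>

text \<open>The mean value theorem for \<open>p\<close> and \<open>q\<close> in any order, possibly
  equal. The intermediate point is no farther from \<open>c\<close> than the farther endpoint, which
  is what the error estimates use.\<close>

lemma mvt_real:
  fixes h :: "real \<Rightarrow> real"
  assumes "\<And>t. t \<in> ball c \<nu> \<Longrightarrow> (h has_real_derivative h' t) (at t)" "p \<in> ball c \<nu>" "q \<in> ball c \<nu>"
  obtains \<xi> where "\<xi> \<in> ball c \<nu>" "\<bar>\<xi> - c\<bar> \<le> max \<bar>p - c\<bar> \<bar>q - c\<bar>" "h q - h p = h' \<xi> * (q - p)"
proof -
  have *: "\<exists>\<xi>. \<xi> \<in> ball c \<nu> \<and> \<bar>\<xi> - c\<bar> \<le> max \<bar>p - c\<bar> \<bar>q - c\<bar> \<and> h q - h p = h' \<xi> * (q - p)"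
    if "p < q" "p \<in> ball c \<nu>" "q \<in> ball c \<nu>" for p q
  proof -
    have sub: "t \<in> ball c \<nu>" if "p \<le> t" "t \<le> q" for t
      using that \<open>p \<in> ball c \<nu>\<close> \<open>q \<in> ball c \<nu>\<close> by (auto simp: dist_real_def)
    then obtain \<xi> where "p < \<xi>" "\<xi> < q" "h q - h p = (q - p) * h' \<xi>"
      using MVT2[of p q h h'] assms(1) \<open>p < q\<close> by auto
    then show ?thesis
      using sub by (intro exI[of _ \<xi>]) auto
  qed
  consider "p < q" | "q < p" | "p = q"
    by linarith
  then show thesis
  proof cases
    case 1
    then show ?thesis using *[of p q] assms that by blast
  next
    case 2
    then obtain \<xi> where "\<xi> \<in> ball c \<nu>" "\<bar>\<xi> - c\<bar> \<le> max \<bar>q - c\<bar> \<bar>p - c\<bar>" "h p - h q = h' \<xi> * (p - q)"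
      using *[of q p] assms by blast
    then show ?thesis
      by (intro that[of \<xi>]) (auto simp: algebra_simps max.commute)
  next
    case 3
    then show ?thesis using assms(2) by (intro that[of p]) auto
  qed
qed

text \<open>Both derivatives are expanded to first order: \<open>a\<^sub>1\<close> around its zero \<open>c\<close>, \<open>b\<^sub>1\<close> around its zero
  \<open>p\<close>. As they agree at \<open>q\<close> and \<open>r\<close>, the second derivatives agree at a point between \<open>q\<close>
  and \<open>r\<close> and hence differ by little near \<open>c\<close>.\<close>

lemma secant_newton_step:
  fixes a1 b1 :: "real \<Rightarrow> real"
  assumes a1: "\<And>t. t \<in> ball c \<nu> \<Longrightarrow> (a1 has_real_derivative a2 t) (at t)"
    and a2: "\<And>t. t \<in> ball c \<nu> \<Longrightarrow> (a2 has_real_derivative a3 t) (at t)"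
    and a3: "\<And>t. t \<in> ball c \<nu> \<Longrightarrow> \<bar>a3 t\<bar> \<le> M"
    and b1: "\<And>t. t \<in> ball c \<nu> \<Longrightarrow> (b1 has_real_derivative b2 t) (at t)"
    and b2: "\<And>t. t \<in> ball c \<nu> \<Longrightarrow> (b2 has_real_derivative b3 t) (at t)"
    and b3: "\<And>t. t \<in> ball c \<nu> \<Longrightarrow> \<bar>b3 t\<bar> \<le> M"
    and zero: "a1 c = 0" "b1 p = 0" and agree: "a1 q = b1 q" "a1 r = b1 r" "q \<noteq> r"
    and near: "\<bar>p - c\<bar> \<le> \<delta>" "\<bar>q - c\<bar> \<le> \<delta>" "\<bar>r - c\<bar> \<le> \<delta>" "\<delta> < \<nu>"
    and \<delta>: "0 < M" "14 * M * \<delta> \<le> \<bar>a2 c\<bar>"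
  shows "\<bar>a2 c\<bar> * \<bar>p - c\<bar> \<le> 8 * M * (\<bar>q - c\<bar> * max \<bar>q - c\<bar> \<bar>r - c\<bar>)"
proof -
  have balls: "c \<in> ball c \<nu>" "p \<in> ball c \<nu>" "q \<in> ball c \<nu>" "r \<in> ball c \<nu>"
    using near by (auto simp: dist_real_def)
  have lip: "\<bar>h2 s - h2 t\<bar> \<le> M * (\<bar>s - c\<bar> + \<bar>t - c\<bar>)"
    if h2: "\<And>t. t \<in> ball c \<nu> \<Longrightarrow> (h2 has_real_derivative h3 t) (at t)"
      and h3: "\<And>t. t \<in> ball c \<nu> \<Longrightarrow> \<bar>h3 t\<bar> \<le> M" and st: "s \<in> ball c \<nu>" "t \<in> ball c \<nu>"
    for h2 h3 :: "real \<Rightarrow> real" and s t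
  proof -
    obtain \<xi> where "\<xi> \<in> ball c \<nu>" "h2 s - h2 t = h3 \<xi> * (s - t)"
      using mvt_real[OF h2 st(2,1)] by blast
    then have "\<bar>h2 s - h2 t\<bar> \<le> M * \<bar>s - t\<bar>"
      using h3 by (auto simp: abs_mult intro: mult_right_mono)
    also have "\<dots> \<le> M * (\<bar>s - c\<bar> + \<bar>t - c\<bar>)"
      using \<delta> by (intro mult_left_mono) auto
    finally show ?thesis .
  qed
  obtain \<xi>1 where \<xi>1: "\<xi>1 \<in> ball c \<nu>" "\<bar>\<xi>1 - c\<bar> \<le> max \<bar>c - c\<bar> \<bar>q - c\<bar>" "a1 q - a1 c = a2 \<xi>1 * (q - c)"
    using mvt_real[OF a1 balls(1,3)] by blast
  obtain \<xi>2 where \<xi>2: "\<xi>2 \<in> ball c \<nu>" "\<bar>\<xi>2 - c\<bar> \<le> max \<bar>p - c\<bar> \<bar>q - c\<bar>" "b1 q - b1 p = b2 \<xi>2 * (q - p)"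
    using mvt_real[OF b1 balls(2,3)] by blast
  obtain \<xi>3 where \<xi>3: "\<xi>3 \<in> ball c \<nu>" "\<bar>\<xi>3 - c\<bar> \<le> max \<bar>q - c\<bar> \<bar>r - c\<bar>"
    "(a1 r - b1 r) - (a1 q - b1 q) = (a2 \<xi>3 - b2 \<xi>3) * (r - q)"
    using mvt_real[OF DERIV_diff[OF a1 b1] balls(3,4)] by blast
  have eq3: "a2 \<xi>3 = b2 \<xi>3"
    using \<xi>3(3) agree by simp
  define ep eq E where "ep = \<bar>p - c\<bar>" and "eq = \<bar>q - c\<bar>" and "E = max \<bar>q - c\<bar> \<bar>r - c\<bar>"
  have e: "0 \<le> ep" "0 \<le> eq" "eq \<le> E" "E \<le> \<delta>" "ep \<le> \<delta>"
    using near by (auto simp: ep_def eq_def E_def)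
  have "\<bar>b2 \<xi>2 - b2 \<xi>3\<bar> \<le> M * (\<bar>\<xi>2 - c\<bar> + \<bar>\<xi>3 - c\<bar>)"
    by (rule lip[OF b2 b3 \<xi>2(1) \<xi>3(1)])
  also have "\<dots> \<le> M * (ep + eq + E)"
  proof (rule mult_left_mono)
    have "max ep eq \<le> ep + eq"
      using e(1,2) by simp
    then have "\<bar>\<xi>2 - c\<bar> \<le> ep + eq"
      using \<xi>2(2) unfolding ep_def eq_def by (rule order_trans[rotated])
    then show "\<bar>\<xi>2 - c\<bar> + \<bar>\<xi>3 - c\<bar> \<le> ep + eq + E"
      using \<xi>3(2) unfolding E_def by (rule add_mono)
  qed (use \<delta> in simp)
  finally have 1: "\<bar>b2 \<xi>2 - b2 \<xi>3\<bar> \<le> M * (ep + eq + E)" .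
  have "\<bar>a2 \<xi>3 - a2 \<xi>1\<bar> \<le> M * (\<bar>\<xi>3 - c\<bar> + \<bar>\<xi>1 - c\<bar>)"
    by (rule lip[OF a2 a3 \<xi>3(1) \<xi>1(1)])
  also have "\<dots> \<le> M * (E + eq)"
    using \<delta> \<xi>1(2) \<xi>3(2) by (intro mult_left_mono) (auto simp: eq_def E_def)
  finally have 2: "\<bar>a2 \<xi>3 - a2 \<xi>1\<bar> \<le> M * (E + eq)" .
  have "\<bar>b2 \<xi>2 - a2 \<xi>1\<bar> \<le> M * (ep + eq + E) + M * (E + eq)"
    using 1 2 eq3 by linarith
  also have "\<dots> = M * (ep + 2 * eq + 2 * E)"
    by (simp add: algebra_simps)
  also have "\<dots> \<le> M * (ep + 4 * E)"
    using \<delta> e by (intro mult_left_mono) auto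
  finally have diff: "\<bar>b2 \<xi>2 - a2 \<xi>1\<bar> \<le> M * (ep + 4 * E)" .
  have "\<bar>a2 c - a2 \<xi>1\<bar> \<le> M * (\<bar>c - c\<bar> + \<bar>\<xi>1 - c\<bar>)"
    by (rule lip[OF a2 a3 balls(1) \<xi>1(1)])
  also have "\<dots> \<le> M * \<delta>"
    using \<delta> \<xi>1(2) near by (intro mult_left_mono) auto
  finally have low: "\<bar>a2 c\<bar> - M * \<delta> \<le> \<bar>a2 \<xi>1\<bar>"
    by linarith
  \<comment> \<open>The two expansions give
    \<open>a2 \<xi>1 * (q - c) = b2 \<xi>2 * (q - p)\<close>; subtracting
    \<open>a2 \<xi>1 * (q - p)\<close> leaves the error of \<open>p\<close> as a product of two
    small factors.\<close>
  have "a2 \<xi>1 * (p - c) = (b2 \<xi>2 - a2 \<xi>1) * (q - p)"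
    using \<xi>1(3) \<xi>2(3) zero agree(1) by (simp add: algebra_simps)
  then have "\<bar>a2 \<xi>1\<bar> * ep = \<bar>b2 \<xi>2 - a2 \<xi>1\<bar> * \<bar>q - p\<bar>"
    by (metis abs_mult ep_def)
  also have "\<dots> \<le> (M * (ep + 4 * E)) * (ep + eq)"
    using diff e \<delta> by (intro mult_mono) (auto simp: ep_def eq_def)
  also have "\<dots> = M * (ep * (ep + eq + 4 * E)) + 4 * M * (eq * E)"
    by (simp add: algebra_simps)
  \<comment> \<open>One factor of the terms containing \<open>ep\<close> is bounded by
    \<open>6 * \<delta>\<close>, so that these terms can be absorbed on the left.\<close>
  also have "\<dots> \<le> M * (ep * (6 * \<delta>)) + 4 * M * (eq * E)"
    using \<delta> e by (intro add_right_mono mult_left_mono) auto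
  finally have "\<bar>a2 \<xi>1\<bar> * ep \<le> 6 * (M * \<delta>) * ep + 4 * M * (eq * E)"
    by (simp add: mult_ac)
  moreover have "(\<bar>a2 c\<bar> - M * \<delta>) * ep \<le> \<bar>a2 \<xi>1\<bar> * ep"
    using low e by (intro mult_right_mono)
  \<comment> \<open>The losses \<open>6 * M * \<delta>\<close> and \<open>M * \<delta>\<close> add
    up to at most half of \<open>\<bar>a2 c\<bar>\<close>; the remaining half turns the constant 4
    into 8.\<close>
  moreover have "(14 * M * \<delta>) * ep \<le> \<bar>a2 c\<bar> * ep"
    using \<delta> e by (intro mult_right_mono)
  ultimately have "\<bar>a2 c\<bar> * ep \<le> 8 * M * (eq * E)"
    by (simp add: algebra_simps)
  then show ?thesis
    by (simp add: ep_def eq_def E_def)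
qed


section \<open>The Lagrangian system along a branch\<close>

text \<open>Numbering the directions \<open>x\<close>, \<open>Re z\<close>, \<open>Im z\<close> by
  0, 1, 2 lets lists of numbers name mixed partials. All indices from 2 on give the last direction,
  so every list stays within \<open>Basis\<close>.\<close>

definition edir :: "nat \<Rightarrow> real \<times> complex" where
  "edir i = (if i = 0 then (1, 0) else if i = 1 then (0, 1) else (0, \<i>))"

lemma edir_Basis: "set (map edir bs) \<subseteq> Basis"
  by (auto simp: edir_def Basis_prod_def Basis_complex_def)

abbreviation pencil_sigma :: "(real \<Rightarrow> complex \<Rightarrow> complex mat) \<Rightarrow> real \<times> complex \<Rightarrow> real" where
  "pencil_sigma P \<equiv> \<lambda>(x, z). sigma_min (P x z)"

section \<open>Chain rules for the singular value function and the Lagrangian\<close>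

lemma derivative_along_curve:
  fixes F :: "real \<times> complex \<Rightarrow> real"
  assumes F: "F differentiable (at (x, z x))"
    and z1: "((\<lambda>t. Re (z t)) has_real_derivative d1) (at x)"
    and z2: "((\<lambda>t. Im (z t)) has_real_derivative d2) (at x)"
  shows "((\<lambda>t. F (t, z t)) has_real_derivative
    frechet_derivative F (at (x, z x)) (edir 0) + d1 * frechet_derivative F (at (x, z x)) (edir 1)
      + d2 * frechet_derivative F (at (x, z x)) (edir 2)) (at x)"
proof -
  let ?D = "frechet_derivative F (at (x, z x))"
  have D: "(F has_derivative ?D) (at (x, z x))"
    using F by (simp add: frechet_derivative_works)
  then interpret D: bounded_linear ?D
    by (rule has_derivative_bounded_linear)
  have zt: "z t = Re (z t) *\<^sub>R 1 + Im (z t) *\<^sub>R \<i>" for t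
    by (simp add: complex_eq_iff)
  have z1': "((\<lambda>t. Re (z t)) has_derivative (\<lambda>h. h * d1)) (at x)"
    and z2': "((\<lambda>t. Im (z t)) has_derivative (\<lambda>h. h * d2)) (at x)"
    using z1 z2 by (simp_all add: has_field_derivative_def mult_commute_abs)
  have "((\<lambda>t. Re (z t) *\<^sub>R (1::complex) + Im (z t) *\<^sub>R \<i>) has_derivative
      (\<lambda>h. (h * d1) *\<^sub>R 1 + (h * d2) *\<^sub>R \<i>)) (at x)"
    by (intro has_derivative_add has_derivative_scaleR_left z1' z2')
  then have "(z has_derivative (\<lambda>h. (h * d1) *\<^sub>R 1 + (h * d2) *\<^sub>R \<i>)) (at x)"
    unfolding zt[symmetric] .
  then have "((\<lambda>t. (t, z t)) has_derivative (\<lambda>h. (h, (h * d1) *\<^sub>R 1 + (h * d2) *\<^sub>R \<i>))) (at x)"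
    by (intro has_derivative_Pair has_derivative_ident)
  from has_derivative_compose[OF this D]
  have "((\<lambda>t. F (t, z t)) has_derivative (\<lambda>h. ?D (h, (h * d1) *\<^sub>R 1 + (h * d2) *\<^sub>R \<i>))) (at x)" .
  moreover have "?D (h, (h * d1) *\<^sub>R 1 + (h * d2) *\<^sub>R \<i>) = (?D (edir 0) + d1 * ?D (edir 1) + d2 * ?D (edir 2)) * h"
    for h
  proof -
    have "(h, (h * d1) *\<^sub>R 1 + (h * d2) *\<^sub>R \<i>) = h *\<^sub>R edir 0 + ((h * d1) *\<^sub>R edir 1 + (h * d2) *\<^sub>R edir 2)"
      by (simp add: edir_def)
    then show ?thesis
      by (simp only: D.add D.scaleR) (simp add: algebra_simps)
  qed
  ultimately show ?thesis
    by (simp add: has_field_derivative_def)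
qed

lemma derivative_slice:
  fixes F :: "real \<times> complex \<Rightarrow> real"
  assumes F: "F differentiable (at (x, z))"
  shows "((\<lambda>w. F (x, fst w)) has_derivative (\<lambda>d. frechet_derivative F (at (x, z)) (0, fst d))) (at (z, \<mu>::real))"
proof -
  have D: "(F has_derivative frechet_derivative F (at (x, z))) (at (x, fst (z, \<mu>)))"
    using F by (simp add: frechet_derivative_works)
  have "((\<lambda>w. (x, fst w)) has_derivative (\<lambda>d. (0, fst d))) (at (z, \<mu>))"
    by (intro has_derivative_Pair has_derivative_const has_derivative_fst has_derivative_ident)
  from has_derivative_compose[OF this D] show ?thesis .
qed

lemma derivative_affine_slice:
  fixes F :: "real \<times> complex \<Rightarrow> real"
  assumes F: "F differentiable (at (x, z))"
  shows "((\<lambda>w. c - snd w * F (x, fst w)) has_derivative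
    (\<lambda>d. - (snd d * F (x, z)) - \<mu> * frechet_derivative F (at (x, z)) (0, fst d))) (at (z, \<mu>))"
  by (rule derivative_eq_intros derivative_slice[OF F] refl)+ (simp add: algebra_simps)

lemma lagrangian_derivative:
  assumes "pencil_sigma P differentiable (at (x, z))"
  shows "(lagrangian \<epsilon> (P x) has_derivative
    (\<lambda>d. Re (fst d) - snd d * (pencil_sigma P (x, z) - \<epsilon>)
      - \<mu> * frechet_derivative (pencil_sigma P) (at (x, z)) (0, fst d))) (at (z, \<mu>))"
proof -
  have "((\<lambda>w. Re (fst w) + (0 - snd w * pencil_sigma P (x, fst w)) + snd w * \<epsilon>) has_derivative
      (\<lambda>d. Re (fst d) + (- (snd d * pencil_sigma P (x, z))
        - \<mu> * frechet_derivative (pencil_sigma P) (at (x, z)) (0, fst d)) + snd d * \<epsilon>)) (at (z, \<mu>))"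
    by (intro derivative_intros derivative_affine_slice assms)
  then show ?thesis
    by (simp add: lagrangian_def[abs_def] algebra_simps)
qed

text \<open>Along the segment from \<open>y\<close> to a point \<open>q\<close> of \<open>S\<close>
  the difference \<open>f - g\<close> vanishes, so its derivative kills \<open>q - y\<close>. With
  \<open>q\<close> ranging over an inner ball, differences of such vectors reach every direction up
  to scaling.\<close>

lemma has_derivative_unique_convex:
  fixes f g :: "'a::real_normed_vector \<Rightarrow> real"
  assumes f: "(f has_derivative D1) (at y)" and g: "(g has_derivative D2) (at y)"
    and S: "convex S" "y \<in> S" "interior S \<noteq> {}" and eq: "\<And>q. q \<in> S \<Longrightarrow> f q = g q"
  shows "D1 = D2"
proof -
  define D where "D = (\<lambda>d. D1 d - D2 d)"
  have h: "((\<lambda>q. f q - g q) has_derivative D) (at y)"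
    unfolding D_def by (intro has_derivative_diff f g)
  then interpret D: bounded_linear D
    by (rule has_derivative_bounded_linear)
  have zero: "D (q - y) = 0" if q: "q \<in> S" for q
  proof -
    let ?l = "\<lambda>t::real. y + t *\<^sub>R (q - y)"
    have l: "(?l has_derivative (\<lambda>t. t *\<^sub>R (q - y))) (at 0 within {0..1})"
      by (auto intro!: derivative_eq_intros)
    have "((\<lambda>t. f (?l t) - g (?l t)) has_derivative (\<lambda>t. D (t *\<^sub>R (q - y)))) (at 0 within {0..1})"
      using has_derivative_compose[OF l, of "\<lambda>q. f q - g q" D] h by simp
    then have "((\<lambda>t. f (?l t) - g (?l t)) has_vector_derivative D (q - y)) (at 0 within {0..1})"
      by (simp add: has_vector_derivative_def D.scaleR)
    moreover have "f (?l t) - g (?l t) = 0" if "t \<in> {0..1}" for t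
    proof -
      have "?l t = (1 - t) *\<^sub>R y + t *\<^sub>R q"
        by (simp add: algebra_simps)
      then have "?l t \<in> S"
        using convexD[OF S(1,2) q, of "1 - t" t] that by simp
      then show ?thesis
        using eq by simp
    qed
    ultimately have "((\<lambda>t. 0) has_vector_derivative D (q - y)) (at 0 within {0..1::real})"
      by (elim has_vector_derivative_transform[rotated 2]) auto
    moreover have "((\<lambda>t. 0) has_vector_derivative (0::real)) (at 0 within {0..1::real})"
      by (rule has_vector_derivative_const)
    ultimately show ?thesis
      by (intro vector_derivative_unique_within_closed_interval[of 0 1 0 "\<lambda>t. 0"]) auto
  qed
  obtain q0 r where r: "0 < r" "ball q0 r \<subseteq> S"
    using S(3) by (meson equals0I mem_interior)
  have "D d = 0" for d
  proof -
    define s where "s = r / (2 * (norm d + 1))"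
    have s: "0 < s"
      using r by (simp add: s_def add_nonneg_pos)
    have "s * norm d < r"
    proof -
      have "s * norm d \<le> s * (norm d + 1)"
        using s by simp
      also have "\<dots> = r / 2"
        unfolding s_def using norm_ge_zero[of d] by (simp add: field_simps add_nonneg_eq_0_iff)
      finally show ?thesis
        using r by simp
    qed
    then have "q0 + s *\<^sub>R d \<in> S" "q0 \<in> S"
      using r s by (auto simp: subset_iff dist_norm)
    then have "D (q0 + s *\<^sub>R d - y) - D (q0 - y) = 0"
      using zero by simp
    then have "D (s *\<^sub>R d) = 0"
      by (simp add: D.diff[symmetric])
    then show ?thesis
      using s by (simp add: D.scaleR)
  qed
  then show ?thesis
    by (auto simp: D_def fun_eq_iff)
qed

text \<open>The point \<open>z\<close> may lie on the boundary of \<open>cball zs \<nu>z\<close>, where nothing is known about the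
  derivatives of \<open>\<sigma>\<close> on the outside; convexity of the ball makes its inside sufficient.\<close>

lemma lagrangian_partials:
  fixes P :: "real \<Rightarrow> complex \<Rightarrow> complex mat"
  assumes bd: "three_derivatives_bounded (pencil_sigma P) (cball xs \<nu>x \<times> cball zs \<nu>z) C"
    and x: "x \<in> cball xs \<nu>x" and z: "z \<in> cball zs \<nu>z" and \<nu>z: "0 < \<nu>z"
    and L: "twice_differentiable_at (lagrangian \<epsilon> (P x)) (z, \<mu>)"
  defines "G \<equiv> \<lambda>bs. partials (map edir bs) (pencil_sigma P) (x, z)"
  shows "partials [d, (1, 0)] (lagrangian \<epsilon> (P x)) (z, \<mu>)
      = - (snd d * G [1]) - \<mu> * frechet_derivative (partials [edir 1] (pencil_sigma P)) (at (x, z)) (0, fst d)"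
    and "partials [d, (\<i>, 0)] (lagrangian \<epsilon> (P x)) (z, \<mu>)
      = - (snd d * G [2]) - \<mu> * frechet_derivative (partials [edir 2] (pencil_sigma P)) (at (x, z)) (0, fst d)"
    and "partials [d, (0, 1)] (lagrangian \<epsilon> (P x)) (z, \<mu>)
      = - frechet_derivative (pencil_sigma P) (at (x, z)) (0, fst d)"
proof -
  let ?s = "pencil_sigma P" and ?L = "lagrangian \<epsilon> (P x)"
  have diff: "partials (map edir bs) ?s differentiable (at (x, w))"
    if "length bs \<le> 2" "w \<in> cball zs \<nu>z" for bs w
    using bd x that edir_Basis[of bs] unfolding three_derivatives_bounded_def by simp
  have first: "partials [b] ?L (w, m) = Re (fst b) - snd b * (?s (x, w) - \<epsilon>)
      - m * frechet_derivative ?s (at (x, w)) (0, fst b)" if "w \<in> cball zs \<nu>z" for b w m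
    using frechet_derivative_at[OF lagrangian_derivative[of P x w \<epsilon> m]] diff[of "[]" w] that
    by (simp add: fun_eq_iff)
  \<comment> \<open>On the ball the first partial coincides with an explicit function
    \<open>h\<close>; uniqueness of derivatives on a convex set identifies their derivatives even if
    \<open>z\<close> is a boundary point.\<close>
  have second: "partials [d, b] ?L (z, \<mu>) = T d"
    if b: "b \<in> Basis" and h: "(h has_derivative T) (at (z, \<mu>))"
      and eq: "\<And>w m. w \<in> cball zs \<nu>z \<Longrightarrow> partials [b] ?L (w, m) = h (w, m)" for b h T
  proof -
    have "(partials [b] ?L has_derivative frechet_derivative (partials [b] ?L) (at (z, \<mu>))) (at (z, \<mu>))"
      using L b by (simp add: twice_differentiable_at_def frechet_derivative_works)
    then have "frechet_derivative (partials [b] ?L) (at (z, \<mu>)) = T"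
    proof (rule has_derivative_unique_convex[OF _ h, where S = "cball zs \<nu>z \<times> UNIV"])
      show "convex (cball zs \<nu>z \<times> UNIV)"
        by (intro convex_Times) auto
      show "interior (cball zs \<nu>z \<times> (UNIV::real set)) \<noteq> {}"
        using \<nu>z by (simp add: interior_Times)
    qed (use z eq in auto)
    then show ?thesis by simp
  qed
  have B: "(1, 0) \<in> (Basis :: (complex \<times> real) set)" "(\<i>, 0) \<in> (Basis :: (complex \<times> real) set)"
    "(0, 1) \<in> (Basis :: (complex \<times> real) set)"
    by (auto simp: Basis_prod_def Basis_complex_def)
  have h1: "((\<lambda>w. 1 - snd w * partials [edir 1] ?s (x, fst w)) has_derivative
      (\<lambda>d. - (snd d * partials [edir 1] ?s (x, z))
        - \<mu> * frechet_derivative (partials [edir 1] ?s) (at (x, z)) (0, fst d))) (at (z, \<mu>))"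
    by (rule derivative_affine_slice) (use diff[of "[1]" z] z in simp)
  show "partials [d, (1, 0)] ?L (z, \<mu>)
      = - (snd d * G [1]) - \<mu> * frechet_derivative (partials [edir 1] ?s) (at (x, z)) (0, fst d)"
    by (subst second[OF B(1) h1]) (simp_all add: first G_def edir_def del: partials.simps(2), simp_all add: edir_def)
  have h2: "((\<lambda>w. 0 - snd w * partials [edir 2] ?s (x, fst w)) has_derivative
      (\<lambda>d. - (snd d * partials [edir 2] ?s (x, z))
        - \<mu> * frechet_derivative (partials [edir 2] ?s) (at (x, z)) (0, fst d))) (at (z, \<mu>))"
    by (rule derivative_affine_slice) (use diff[of "[2]" z] z in simp)
  show "partials [d, (\<i>, 0)] ?L (z, \<mu>)
      = - (snd d * G [2]) - \<mu> * frechet_derivative (partials [edir 2] ?s) (at (x, z)) (0, fst d)"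
    by (subst second[OF B(2) h2]) (simp_all add: first G_def edir_def del: partials.simps(2), simp_all add: edir_def)
  have h3: "((\<lambda>w. \<epsilon> - ?s (x, fst w)) has_derivative (\<lambda>d. 0 - frechet_derivative ?s (at (x, z)) (0, fst d))) (at (z, \<mu>))"
    using diff[of "[]" z] z by (intro has_derivative_diff has_derivative_const derivative_slice) simp
  have zero: "frechet_derivative ?s (at (x, w)) (0, 0) = 0" if "w \<in> cball zs \<nu>z" for w
    using linear_0[OF linear_frechet_derivative[OF diff[of "[]" w]]] that by (simp add: zero_prod_def)
  show "partials [d, (0, 1)] ?L (z, \<mu>) = - frechet_derivative ?s (at (x, z)) (0, fst d)"
    by (subst second[OF B(3) h3]) (simp_all add: first zero del: partials.simps(2))
qed

text \<open>The three bounded expressions are, up to sign, the components of the transposed Hessian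
  applied to \<open>(a0, a1, a2)\<close>. The vector will be the first and then the second
  derivative of the branch.\<close>

lemma branch_linear_system:
  fixes P :: "real \<Rightarrow> complex \<Rightarrow> complex mat"
  assumes bd: "three_derivatives_bounded (pencil_sigma P) (cball xs \<nu>x \<times> cball zs \<nu>z) C"
    and x: "x \<in> cball xs \<nu>x" and z: "z \<in> cball zs \<nu>z" and \<nu>z: "0 < \<nu>z"
    and g: "0 < g" "hessian_sigma_min_ge g (lagrangian \<epsilon> (P x)) (z, \<mu>)"
  defines "G \<equiv> \<lambda>bs. partials (map edir bs) (pencil_sigma P) (x, z)"
  assumes r: "\<bar>\<mu> * (G [1, 1] * a0 + G [2, 1] * a1) + G [1] * a2\<bar> \<le> R"
    "\<bar>\<mu> * (G [1, 2] * a0 + G [2, 2] * a1) + G [2] * a2\<bar> \<le> R"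
    "\<bar>G [1] * a0 + G [2] * a1\<bar> \<le> R"
  shows "\<bar>a0\<bar> \<le> 2 * R / g" "\<bar>a1\<bar> \<le> 2 * R / g" "\<bar>a2\<bar> \<le> 2 * R / g"
proof -
  let ?s = "pencil_sigma P" and ?L = "lagrangian \<epsilon> (P x)"
  let ?H = "hessian ?L (z, \<mu>)"
  have L: "twice_differentiable_at ?L (z, \<mu>)" and gH: "g \<le> sigma_min (map_mat complex_of_real ?H)"
    using g(2) by (auto simp: hessian_sigma_min_ge_def)
  note part = lagrangian_partials[where \<epsilon> = \<epsilon> and \<mu> = \<mu>, OF bd x z \<nu>z L, folded G_def]
  have fd0: "frechet_derivative (partials (map edir bs) ?s) (at (x, z)) (0, 0) = 0" if "length bs \<le> 2" for bs
  proof -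
    have "partials (map edir bs) ?s differentiable (at (x, z))"
      using bd x z that edir_Basis[of bs] unfolding three_derivatives_bounded_def by simp
    from linear_0[OF linear_frechet_derivative[OF this]] show ?thesis
      by (simp add: zero_prod_def)
  qed
  have zero: "frechet_derivative (partials [edir i] ?s) (at (x, z)) (0, 0) = 0"
    "frechet_derivative ?s (at (x, z)) (0, 0) = 0" for i
    using fd0[of "[i]"] fd0[of "[]"] by simp_all
  have e: "(0, 1) = edir 1" "(0, \<i>) = edir 2"
    by (simp_all add: edir_def)
  have H: "?H $$ (0, 0) = - \<mu> * G [1, 1]" "?H $$ (1, 0) = - \<mu> * G [2, 1]" "?H $$ (2, 0) = - G [1]"
    "?H $$ (0, 1) = - \<mu> * G [1, 2]" "?H $$ (1, 1) = - \<mu> * G [2, 2]" "?H $$ (2, 1) = - G [2]"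
    "?H $$ (0, 2) = - G [1]" "?H $$ (1, 2) = - G [2]" "?H $$ (2, 2) = 0"
    unfolding hessian_def
    by (simp_all add: y_basis_def part zero e del: partials.simps) (simp_all add: G_def)
  have "?H \<in> carrier_mat 3 3"
    by (simp add: hessian_def)
  from sigma_min_transpose_bound[OF this g(1) gH, of "\<lambda>i. if i = 0 then a0 else if i = 1 then a1 else a2"]
  have "g\<^sup>2 * (a0\<^sup>2 + a1\<^sup>2 + a2\<^sup>2) \<le>
      (\<mu> * (G [1, 1] * a0 + G [2, 1] * a1) + G [1] * a2)\<^sup>2
      + (\<mu> * (G [1, 2] * a0 + G [2, 2] * a1) + G [2] * a2)\<^sup>2 + (G [1] * a0 + G [2] * a1)\<^sup>2"
    using H by (simp add: numeral_3_eq_3 numeral_2_eq_2) (simp add: power2_eq_square algebra_simps)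
  also have "\<dots> \<le> R\<^sup>2 + R\<^sup>2 + R\<^sup>2"
    using r by (intro add_mono) (simp_all add: abs_le_square_iff[symmetric])
  \<comment> \<open>Three squares are bounded by four, which explains the factor 2 in the
    conclusion.\<close>
  also have "\<dots> \<le> (2 * R)\<^sup>2"
    by (simp add: power_mult_distrib)
  finally have sq: "g\<^sup>2 * (a0\<^sup>2 + a1\<^sup>2 + a2\<^sup>2) \<le> (2 * R)\<^sup>2" .
  have R: "0 \<le> R"
    using r(3) by linarith
  have "\<bar>a\<bar> \<le> 2 * R / g" if "a\<^sup>2 \<le> a0\<^sup>2 + a1\<^sup>2 + a2\<^sup>2" for a
  proof -
    have "(g * \<bar>a\<bar>)\<^sup>2 \<le> g\<^sup>2 * (a0\<^sup>2 + a1\<^sup>2 + a2\<^sup>2)"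
      using that g by (simp add: power_mult_distrib)
    then have "(g * \<bar>a\<bar>)\<^sup>2 \<le> (2 * R)\<^sup>2"
      using sq by linarith
    then have "g * \<bar>a\<bar> \<le> 2 * R"
      by (rule power2_le_imp_le) (use R in simp)
    then show ?thesis
      using g by (simp add: field_simps)
  qed
  then show "\<bar>a0\<bar> \<le> 2 * R / g" "\<bar>a1\<bar> \<le> 2 * R / g" "\<bar>a2\<bar> \<le> 2 * R / g"
    by simp_all
qed


lemma real_derivative_const_on_open:
  fixes h :: "real \<Rightarrow> real"
  assumes "(h has_real_derivative d) (at x)" "open S" "x \<in> S" "\<And>t. t \<in> S \<Longrightarrow> h t = k"
  shows "d = 0"
proof -
  have "((\<lambda>_. k) has_real_derivative d) (at x)"
    using assms by (intro has_field_derivative_transform_within_open[OF assms(1-3)]) auto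
  then show ?thesis
    using DERIV_const DERIV_unique by blast
qed

text \<open>The vanishing differential is evaluated at the basis directions: the multiplier
  direction gives feasibility, the two directions of \<open>z\<close> give stationarity.\<close>

lemma gradient_zero_conditions:
  fixes P :: "real \<Rightarrow> complex \<Rightarrow> complex mat"
  assumes diff: "pencil_sigma P differentiable (at (x, fst y))"
    and zero: "gradient_zero (lagrangian \<epsilon> (P x)) y"
  shows "pencil_sigma P (x, fst y) = \<epsilon>"
    "snd y * frechet_derivative (pencil_sigma P) (at (x, fst y)) (edir 1) = 1"
    "snd y * frechet_derivative (pencil_sigma P) (at (x, fst y)) (edir 2) = 0"
proof -
  have "(lagrangian \<epsilon> (P x) has_derivative
    (\<lambda>d. Re (fst d) - snd d * (pencil_sigma P (x, fst y) - \<epsilon>)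
      - snd y * frechet_derivative (pencil_sigma P) (at (x, fst y)) (0, fst d))) (at y)"
    using lagrangian_derivative[OF diff, of \<epsilon> "snd y"] by simp
  from has_derivative_unique[OF this zero[unfolded gradient_zero_def]]
  have eq: "Re (fst d) - snd d * (pencil_sigma P (x, fst y) - \<epsilon>)
      - snd y * frechet_derivative (pencil_sigma P) (at (x, fst y)) (0, fst d) = 0" for d
    by (simp add: fun_eq_iff)
  have "frechet_derivative (pencil_sigma P) (at (x, fst y)) (0, 0) = 0"
    using linear_0[OF linear_frechet_derivative[OF diff]] by (simp add: zero_prod_def)
  then show "pencil_sigma P (x, fst y) = \<epsilon>"
    using eq[of "(0, 1)"] by simp
  show "snd y * frechet_derivative (pencil_sigma P) (at (x, fst y)) (edir 1) = 1"
    "snd y * frechet_derivative (pencil_sigma P) (at (x, fst y)) (edir 2) = 0"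
    using eq[of "(1, 0)"] eq[of "(\<i>, 0)"] by (simp_all add: edir_def)
qed

text \<open>Differentiating \<open>\<nabla>\<^sub>y \<L>(x, y(x)) = 0\<close> twice bounds \<open>y'\<close> and \<open>y''\<close> through the inverse of the
  Hessian. The envelope identity \<open>z\<^sub>1' = - \<mu> \<sigma>\<^sub>x\<close> then gains one order: \<open>z\<^sub>1'''\<close> involves
  neither \<open>y'''\<close> nor fourth derivatives of \<open>\<sigma>\<close>.\<close>

lemma analytic_branch_third_derivative:
  fixes \<gamma> \<epsilon> C xs \<mu>s \<nu>x \<nu>z \<nu>\<mu> :: real and zs :: complex
  assumes \<gamma>: "0 < \<gamma>" and \<nu>: "0 < \<nu>x" "0 < \<nu>z"
  obtains M where "0 < M"
    "\<And>P y. analytic_branch \<gamma> \<epsilon> C P xs zs \<mu>s \<nu>x \<nu>z \<nu>\<mu> y \<Longrightarrow> \<exists>a1 a2 a3. \<forall>x\<in>ball xs \<nu>x.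
      ((\<lambda>x. Re (fst (y x))) has_real_derivative a1 x) (at x) \<and>
      (a1 has_real_derivative a2 x) (at x) \<and> (a2 has_real_derivative a3 x) (at x) \<and> \<bar>a3 x\<bar> \<le> M"
proof -
  define g where "g = \<gamma> / 2"
  have g: "0 < g"
    using \<gamma> by (simp add: g_def)
  \<comment> \<open>\<open>B\<close> bounds the multiplier, \<open>Y1\<close> and \<open>Y2\<close>
    the first and second derivatives of the branch. \<open>C1\<close> bounds the total derivatives
    of the partials of sigma along the branch, and \<open>C2\<close> their second derivatives apart
    from the terms with \<open>z''\<close>.\<close>
  define B where "B = \<bar>\<mu>s\<bar> + \<nu>\<mu>"
  define Y1 where "Y1 = 2 * ((B + 1) * C) / g"
  define C1 where "C1 = C + Y1 * C + Y1 * C"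
  define C2 where "C2 = C1 + Y1 * C1 + Y1 * C1"
  define Y2 where "Y2 = 2 * (2 * (Y1 * C1) + (B + 1) * C2) / g"
  define M where "M = Y2 * C + 2 * (Y1 * C1) + B * (C2 + Y2 * C + Y2 * C)"
  have main: "\<exists>a1 a2 a3. \<forall>x\<in>ball xs \<nu>x.
      ((\<lambda>x. Re (fst (y x))) has_real_derivative a1 x) (at x) \<and>
      (a1 has_real_derivative a2 x) (at x) \<and> (a2 has_real_derivative a3 x) (at x) \<and> \<bar>a3 x\<bar> \<le> M"
    if br: "analytic_branch \<gamma> \<epsilon> C P xs zs \<mu>s \<nu>x \<nu>z \<nu>\<mu> y" for P y
  proof -
    define J where "J = ball xs \<nu>x"
    have J: "open J" "J \<subseteq> cball xs \<nu>x"
      by (auto simp: J_def)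
    define z1 z2 m where "z1 = (\<lambda>x. Re (fst (y x)))" and "z2 = (\<lambda>x. Im (fst (y x)))"
      and "m = (\<lambda>x. snd (y x))"
    have bd: "three_derivatives_bounded (pencil_sigma P) (cball xs \<nu>x \<times> cball zs \<nu>z) C"
      and an: "real_analytic_on y J"
      using br real_analytic_on_subset[OF _ J(2)] unfolding analytic_branch_def by auto
    have point: "x \<in> cball xs \<nu>x" "fst (y x) \<in> cball zs \<nu>z" "m x \<in> cball \<mu>s \<nu>\<mu>"
      "gradient_zero (lagrangian \<epsilon> (P x)) (y x)"
      "hessian_sigma_min_ge g (lagrangian \<epsilon> (P x)) (fst (y x), m x)" if "x \<in> J" for x
      using br that J(2) unfolding analytic_branch_def g_def m_def
      by (auto simp: mem_Times_iff)
    have mB: "\<bar>m x\<bar> \<le> B" if "x \<in> J" for x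
      using point(3)[OF that] by (auto simp: B_def dist_real_def)
    have an1: "real_analytic_on z1 J" "real_analytic_on z2 J" "real_analytic_on m J"
      unfolding z1_def z2_def m_def
      by (rule
          real_analytic_on_bounded_linear[OF bounded_linear_compose[OF bounded_linear_Re bounded_linear_fst] an]
          real_analytic_on_bounded_linear[OF bounded_linear_compose[OF bounded_linear_Im bounded_linear_fst] an]
          real_analytic_on_bounded_linear[OF bounded_linear_snd an])+
    define z1' z2' m' where "z1' = deriv z1" and "z2' = deriv z2" and "m' = deriv m"
    have an2: "real_analytic_on z1' J" "real_analytic_on z2' J" "real_analytic_on m' J"
      unfolding z1'_def z2'_def m'_def by (intro real_analytic_on_deriv(2)[OF J(1)] an1)+
    have d1: "(z1 has_real_derivative z1' x) (at x)" "(z2 has_real_derivative z2' x) (at x)"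
      "(m has_real_derivative m' x) (at x)" if "x \<in> J" for x
      unfolding z1'_def z2'_def m'_def
      using real_analytic_on_deriv(1)[OF J(1) _ that] an1 by blast+
    define z1'' z2'' m'' where "z1'' = deriv z1'" and "z2'' = deriv z2'" and "m'' = deriv m'"
    have d2: "(z1' has_real_derivative z1'' x) (at x)" "(z2' has_real_derivative z2'' x) (at x)"
      "(m' has_real_derivative m'' x) (at x)" if "x \<in> J" for x
      unfolding z1''_def z2''_def m''_def
      using real_analytic_on_deriv(1)[OF J(1) _ that] an2 by blast+
    \<comment> \<open>\<open>S\<close> is a partial derivative of sigma along the branch,
      \<open>T\<close> its total derivative in \<open>x\<close>, and \<open>K\<close> the part of
      the derivative of \<open>T\<close> that is free of second derivatives of
      \<open>z\<close>.\<close>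
    define S where "S bs x = partials (map edir bs) (pencil_sigma P) (x, fst (y x))" for bs x
    define T where "T bs x = S (0 # bs) x + z1' x * S (1 # bs) x + z2' x * S (2 # bs) x" for bs x
    define K where "K bs x = T (0 # bs) x + z1' x * T (1 # bs) x + z2' x * T (2 # bs) x" for bs x
    have diff: "partials (map edir bs) (pencil_sigma P) differentiable (at (x, fst (y x)))"
      if "length bs \<le> 2" "x \<in> J" for bs x
      using bd point(1,2)[OF that(2)] that(1) edir_Basis[of bs]
      unfolding three_derivatives_bounded_def by simp
    have SC: "\<bar>S bs x\<bar> \<le> C" if "1 \<le> length bs" "length bs \<le> 3" "x \<in> J" for bs x
      using bd point(1,2)[OF that(3)] that(1,2) edir_Basis[of bs]
      unfolding three_derivatives_bounded_def S_def by simp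
    have C: "0 \<le> C"
      using SC[of "[0]" xs] \<nu> by (simp add: J_def)
    have dS: "(S bs has_real_derivative T bs x) (at x)" if "length bs \<le> 2" "x \<in> J" for bs x
      using derivative_along_curve[where z = "\<lambda>t. fst (y t)", OF diff[OF that], of "z1' x" "z2' x"] d1[OF that(2)]
      unfolding S_def T_def z1_def z2_def by simp
    have dT: "(T bs has_real_derivative (K bs x + z1'' x * S (1 # bs) x + z2'' x * S (2 # bs) x)) (at x)"
      if "length bs \<le> 1" "x \<in> J" for bs x
    proof -
      have "((\<lambda>x. S (0 # bs) x + z1' x * S (1 # bs) x + z2' x * S (2 # bs) x) has_real_derivative
          (T (0 # bs) x + (z1'' x * S (1 # bs) x + T (1 # bs) x * z1' x)
            + (z2'' x * S (2 # bs) x + T (2 # bs) x * z2' x))) (at x)"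
        using that by (intro DERIV_add DERIV_mult dS d2) auto
      then show ?thesis
        by (simp add: T_def[abs_def] K_def algebra_simps)
    qed
    have id: "S [] x = \<epsilon>" "m x * S [1] x = 1" "m x * S [2] x = 0" if "x \<in> J" for x
      using gradient_zero_conditions[where P = P and x = x, OF _ point(4)[OF that]] diff[of "[]" x] that
      unfolding S_def m_def by simp_all
    \<comment> \<open>The identities in \<open>id\<close> have constant right sides on the open set
      \<open>J\<close>. Differentiating them once gives \<open>E0\<close>, \<open>E1\<close>,
      \<open>E2\<close>, and once more \<open>F0\<close>, \<open>F1\<close>,
      \<open>F2\<close>.\<close>
    have E2: "T [] x = 0" if "x \<in> J" for x
      using real_derivative_const_on_open[OF dS[of "[]" x] J(1) that, of \<epsilon>] that id(1) by simp
    have dE: "((\<lambda>x. m x * S [i] x) has_real_derivative (m' x * S [i] x + T [i] x * m x)) (at x)"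
      if "x \<in> J" for x i
      using that by (intro DERIV_mult d1 dS) auto
    have E0: "m' x * S [1] x + T [1] x * m x = 0" if "x \<in> J" for x
      using real_derivative_const_on_open[OF dE[OF that] J(1) that] id(2) by blast
    have E1: "m' x * S [2] x + T [2] x * m x = 0" if "x \<in> J" for x
      using real_derivative_const_on_open[OF dE[OF that] J(1) that] id(3) by blast
    have dE': "((\<lambda>x. m' x * S [i] x + T [i] x * m x) has_real_derivative
        ((m'' x * S [i] x + T [i] x * m' x)
          + ((K [i] x + z1'' x * S [1, i] x + z2'' x * S [2, i] x) * m x + m' x * T [i] x))) (at x)"
      if "x \<in> J" for x i
      using that by (intro DERIV_add DERIV_mult d1 d2 dS dT) auto
    have F0: "(m'' x * S [1] x + T [1] x * m' x)
        + ((K [1] x + z1'' x * S [1, 1] x + z2'' x * S [2, 1] x) * m x + m' x * T [1] x) = 0" if "x \<in> J" for x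
      using real_derivative_const_on_open[OF dE'[OF that] J(1) that] E0 by blast
    have F1: "(m'' x * S [2] x + T [2] x * m' x)
        + ((K [2] x + z1'' x * S [1, 2] x + z2'' x * S [2, 2] x) * m x + m' x * T [2] x) = 0" if "x \<in> J" for x
      using real_derivative_const_on_open[OF dE'[OF that] J(1) that] E1 by blast
    have F2: "K [] x + z1'' x * S [1] x + z2'' x * S [2] x = 0" if "x \<in> J" for x
      using real_derivative_const_on_open[OF dT[of "[]" x] J(1) that, of 0] that E2 by simp
    have B: "0 \<le> B"
      using mB[of xs] \<nu> by (simp add: J_def)
    have bound: "\<bar>a * b\<bar> \<le> p * q" if "\<bar>a\<bar> \<le> p" "\<bar>b\<bar> \<le> q" for a b p q :: real
      unfolding abs_mult using that by (intro mult_mono) auto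
    have Y1: "\<bar>z1' x\<bar> \<le> Y1 \<and> \<bar>z2' x\<bar> \<le> Y1 \<and> \<bar>m' x\<bar> \<le> Y1" if x: "x \<in> J" for x
    proof -
      \<comment> \<open>Collecting the unknown derivatives on the left exhibits the transposed
        Hessian system; the right side contains only the multiplier and partials of sigma.\<close>
      have "m x * (S [1, i] x * z1' x + S [2, i] x * z2' x) + S [i] x * m' x = - (m x * S [0, i] x)"
        if "m' x * S [i] x + T [i] x * m x = 0" for i
        using that by (simp add: T_def algebra_simps)
      then have r: "m x * (S [1, 1] x * z1' x + S [2, 1] x * z2' x) + S [1] x * m' x = - (m x * S [0, 1] x)"
        "m x * (S [1, 2] x * z1' x + S [2, 2] x * z2' x) + S [2] x * m' x = - (m x * S [0, 2] x)"
        "S [1] x * z1' x + S [2] x * z2' x = - S [0] x"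
        using E0[OF x] E1[OF x] E2[OF x] by (auto simp: T_def algebra_simps)
      have "\<bar>m x * S [0, i] x\<bar> \<le> (B + 1) * C" for i
      proof -
        have "\<bar>m x * S [0, i] x\<bar> \<le> B * C"
          using x by (intro bound mB SC) auto
        then show ?thesis
          using C by (simp add: distrib_right)
      qed
      moreover have "\<bar>S [0] x\<bar> \<le> (B + 1) * C"
      proof -
        have "C \<le> (B + 1) * C"
          using B C by (simp add: distrib_right)
        then show ?thesis
          using SC[of "[0]" x] x by simp
      qed
      ultimately show ?thesis
        using branch_linear_system[OF bd point(1,2)[OF x] \<nu>(2) g point(5)[OF x], folded S_def,
            of "z1' x" "z2' x" "m' x" "(B + 1) * C"]
        unfolding r Y1_def by simp
    qed
    have "0 \<le> Y1"
      using B C g by (simp add: Y1_def)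
    have TC: "\<bar>T bs x\<bar> \<le> C1" if "1 \<le> length bs" "length bs \<le> 2" "x \<in> J" for bs x
    proof -
      have "\<bar>S (0 # bs) x\<bar> \<le> C" "\<bar>z1' x * S (1 # bs) x\<bar> \<le> Y1 * C" "\<bar>z2' x * S (2 # bs) x\<bar> \<le> Y1 * C"
        using that Y1 by (intro bound SC; simp)+
      then show ?thesis
        unfolding T_def C1_def by linarith
    qed
    have KC: "\<bar>K bs x\<bar> \<le> C2" if "length bs \<le> 1" "x \<in> J" for bs x
    proof -
      have "\<bar>T (0 # bs) x\<bar> \<le> C1" "\<bar>z1' x * T (1 # bs) x\<bar> \<le> Y1 * C1" "\<bar>z2' x * T (2 # bs) x\<bar> \<le> Y1 * C1"
        using that Y1 by (intro bound TC; simp)+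
      then show ?thesis
        unfolding K_def C2_def by linarith
    qed
    have C1: "0 \<le> C1" and C2: "0 \<le> C2"
      using C \<open>0 \<le> Y1\<close> by (simp_all add: C1_def C2_def)
    have Y2: "\<bar>z1'' x\<bar> \<le> Y2 \<and> \<bar>z2'' x\<bar> \<le> Y2 \<and> \<bar>m'' x\<bar> \<le> Y2" if x: "x \<in> J" for x
    proof -
      let ?R = "2 * (Y1 * C1) + (B + 1) * C2"
      \<comment> \<open>The same matrix now acts on the second derivatives; the right side involves
        the branch derivatives only to first order, through \<open>m'\<close>, \<open>T\<close> and
        \<open>K\<close>.\<close>
      have r: "m x * (S [1, 1] x * z1'' x + S [2, 1] x * z2'' x) + S [1] x * m'' x
          = - (2 * (m' x * T [1] x) + m x * K [1] x)"
        "m x * (S [1, 2] x * z1'' x + S [2, 2] x * z2'' x) + S [2] x * m'' x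
          = - (2 * (m' x * T [2] x) + m x * K [2] x)"
        "S [1] x * z1'' x + S [2] x * z2'' x = - K [] x"
        using F0[OF x] F1[OF x] F2[OF x] by (simp_all add: algebra_simps)
      have "\<bar>2 * (m' x * T [i] x) + m x * K [i] x\<bar> \<le> ?R" for i
      proof -
        have "\<bar>m' x * T [i] x\<bar> \<le> Y1 * C1" "\<bar>m x * K [i] x\<bar> \<le> B * C2"
          using x Y1 by (intro bound TC KC mB; simp)+
        then have "\<bar>2 * (m' x * T [i] x) + m x * K [i] x\<bar> \<le> 2 * (Y1 * C1) + B * C2"
          by linarith
        then show ?thesis
          using C2 by (simp add: distrib_right)
      qed
      moreover have "\<bar>K [] x\<bar> \<le> ?R"
      proof -
        have "C2 \<le> ?R"
          using B C1 C2 \<open>0 \<le> Y1\<close> by (simp add: distrib_right)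
        then show ?thesis
          using KC[of "[]" x] x by simp
      qed
      ultimately show ?thesis
        using branch_linear_system[OF bd point(1,2)[OF x] \<nu>(2) g point(5)[OF x], folded S_def,
            of "z1'' x" "z2'' x" "m'' x" ?R]
        unfolding r Y2_def abs_minus_cancel by blast
    qed
    \<comment> \<open>Multiplying \<open>T [] x = 0\<close> by the multiplier and inserting the
      stationarity conditions isolates \<open>z1'\<close>.\<close>
    have envelope: "z1' x = - (m x * S [0] x)" if "x \<in> J" for x
    proof -
      have "m x * T [] x = m x * S [0] x + z1' x * (m x * S [1] x) + z2' x * (m x * S [2] x)"
        by (simp add: T_def algebra_simps)
      then show ?thesis
        using E2[OF that] id(2,3)[OF that] by simp
    qed
    define a2 where "a2 x = - (m' x * S [0] x + T [0] x * m x)" for x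
    define a3 where "a3 x = - ((m'' x * S [0] x + T [0] x * m' x)
          + ((K [0] x + z1'' x * S [1, 0] x + z2'' x * S [2, 0] x) * m x + m' x * T [0] x))" for x
    have "(z1 has_real_derivative z1' x) (at x) \<and> (z1' has_real_derivative a2 x) (at x) \<and>
        (a2 has_real_derivative a3 x) (at x) \<and> \<bar>a3 x\<bar> \<le> M" if x: "x \<in> J" for x
    proof (intro conjI)
      show "(z1 has_real_derivative z1' x) (at x)"
        by (rule d1(1)[OF x])
      have "((\<lambda>x. - (m x * S [0] x)) has_real_derivative a2 x) (at x)"
        unfolding a2_def by (intro DERIV_minus dE x)
      then show "(z1' has_real_derivative a2 x) (at x)"
        using envelope by (intro has_field_derivative_transform_within_open[OF _ J(1) x, of _ _ z1']) auto
      show "(a2 has_real_derivative a3 x) (at x)"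
        unfolding a2_def[abs_def] a3_def by (intro DERIV_minus dE' x)
      have t: "\<bar>m'' x * S [0] x\<bar> \<le> Y2 * C" "\<bar>T [0] x * m' x\<bar> \<le> C1 * Y1" "\<bar>m' x * T [0] x\<bar> \<le> Y1 * C1"
        "\<bar>z1'' x * S [1, 0] x\<bar> \<le> Y2 * C" "\<bar>z2'' x * S [2, 0] x\<bar> \<le> Y2 * C"
        using x Y1 Y2 by (intro bound SC TC; simp)+
      have "\<bar>K [0] x\<bar> \<le> C2"
        using KC[of "[0]" x] x by simp
      then have "\<bar>K [0] x + z1'' x * S [1, 0] x + z2'' x * S [2, 0] x\<bar> \<le> C2 + Y2 * C + Y2 * C"
        using t(4,5) by linarith
      from bound[OF this mB[OF x]]
      have "\<bar>(K [0] x + z1'' x * S [1, 0] x + z2'' x * S [2, 0] x) * m x\<bar> \<le> B * (C2 + Y2 * C + Y2 * C)"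
        by (simp add: mult.commute)
      then show "\<bar>a3 x\<bar> \<le> M"
        using t(1-3) unfolding a3_def M_def mult.commute[of C1 Y1] by linarith
    qed
    then show ?thesis
      unfolding z1_def J_def by blast
  qed
  show thesis
  \<comment> \<open>The absolute value and the added 1 provide strict positivity.\<close>
  proof (rule that[of "\<bar>M\<bar> + 1"])
    fix P y assume "analytic_branch \<gamma> \<epsilon> C P xs zs \<mu>s \<nu>x \<nu>z \<nu>\<mu> y"
    from main[OF this] show "\<exists>a1 a2 a3. \<forall>x\<in>ball xs \<nu>x.
      ((\<lambda>x. Re (fst (y x))) has_real_derivative a1 x) (at x) \<and>
      (a1 has_real_derivative a2 x) (at x) \<and> (a2 has_real_derivative a3 x) (at x) \<and> \<bar>a3 x\<bar> \<le> \<bar>M\<bar> + 1"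
      by (smt (verit))
  qed simp
qed


section \<open>Convergence of the iterates\<close>

lemma local_min_derivative_zero:
  fixes h :: "real \<Rightarrow> real"
  assumes "(h has_real_derivative d) (at t)" "t \<in> ball c \<nu>" "\<And>s. s \<in> ball c \<nu> \<Longrightarrow> h t \<le> h s"
  shows "d = 0"
proof -
  have "s \<in> ball c \<nu>" if "\<bar>t - s\<bar> < \<nu> - \<bar>t - c\<bar>" for s
    using that by (simp add: dist_real_def)
  then show ?thesis
    using assms(2,3) by (intro DERIV_local_min[OF assms(1), of "\<nu> - \<bar>t - c\<bar>"]) (auto simp: dist_real_def)
qed

theorem theorem3p8:
  fixes n \<kappa> \<eta> :: nat
    and \<Omega> D :: "real set"
    and f :: "nat \<Rightarrow> real \<Rightarrow> real" and Acoef :: "nat \<Rightarrow> complex mat"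
    and A :: "real \<Rightarrow> complex mat"
    and \<epsilon> \<gamma> \<beta> xs \<mu>s \<nu>x \<nu>z \<nu>\<mu> \<delta>0 C :: real and zs :: complex
    and X1 x :: "nat \<Rightarrow> real" and Z1 z :: "nat \<Rightarrow> complex" and W1 v :: "nat \<Rightarrow> complex vec"
    and VV :: "nat \<Rightarrow> complex vec set" and V :: "nat \<Rightarrow> complex mat"
    and P :: "real \<Rightarrow> complex \<Rightarrow> complex mat"
    and Q :: "nat \<Rightarrow> real \<Rightarrow> complex \<Rightarrow> complex mat"
    and y :: "real \<Rightarrow> complex \<times> real" and yV :: "nat \<Rightarrow> real \<Rightarrow> complex \<times> real"
    and us vs :: "real \<Rightarrow> complex vec" and uV vV :: "nat \<Rightarrow> real \<Rightarrow> complex vec"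
  assumes n: "1 \<le> n"
    and \<epsilon>: "0 < \<epsilon>"
    and \<Omega>: "\<Omega> \<noteq> {}" "open \<Omega>"
    and D: "D \<subseteq> \<Omega>" "compact D" "convex D" "interior D \<noteq> {}"
    and f: "\<forall>l\<in>{1..\<kappa>}. real_analytic_on (f l) \<Omega>"
    and Acoef: "\<forall>l\<in>{1..\<kappa>}. Acoef l \<in> carrier_mat n n"
    and A_def: "A = matrix_family n \<kappa> f Acoef"
    \<comment> \<open>the full pencil, the run of the algorithm and the reduced pencils\<close>
    and P_def: "P = full_pencil n A"
    and run: "subspace_framework n A \<epsilon> D \<eta> X1 Z1 W1 x z v VV V"
    and Q_def: "\<And>k. Q k = reduced_pencil A (V k)"
    and nonempty: "\<forall>x'\<in>D. pseudospectrum \<epsilon> (Q 1 x') \<noteq> {}"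
    \<comment> \<open>the optimizer and assumption (N)\<close>
    and minimizer: "xs \<in> \<Omega>"
      "\<forall>x'\<in>\<Omega>. pseudo_abscissa \<epsilon> (P xs) \<le> pseudo_abscissa \<epsilon> (P x')"
    and zs: "zs \<in> pseudospectrum \<epsilon> (P xs)" "Re zs = pseudo_abscissa \<epsilon> (P xs)"
    and N: "nondegenerate \<epsilon> D P xs zs \<mu>s"
    and second_derivative: "(deriv ^^ 2) (\<lambda>x'. pseudo_abscissa \<epsilon> (P x')) xs \<noteq> 0"
    \<comment> \<open>the fixed radii; \<open>\<delta>0\<close> is the closeness threshold for which they are valid\<close>
    and \<gamma>: "0 < \<gamma>"
    and radii: "0 < \<nu>x" "0 < \<nu>z" "0 < \<nu>\<mu>" "0 < \<delta>0" "cball xs \<nu>x \<subseteq> D"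
    and full_branch: "analytic_branch \<gamma> \<epsilon> C P xs zs \<mu>s \<nu>x \<nu>z \<nu>\<mu> y"
      "singular_pair_along P y (cball xs \<nu>x) us vs"
    and reduced_branch: "\<forall>k\<ge>3. iterates_close x xs \<delta>0 k \<longrightarrow>
      robustly_nondegenerate \<gamma> \<epsilon> P (Q k) xs zs \<mu>s \<longrightarrow>
        analytic_branch \<gamma> \<epsilon> C (Q k) xs zs \<mu>s \<nu>x \<nu>z \<nu>\<mu> (yV k) \<and>
        singular_pair_along (Q k) (yV k) (cball xs \<nu>x) (uV k) (vV k)"
    \<comment> \<open>the constant of assumption (B)\<close>
    and \<beta>: "max_product (cball xs \<nu>x) us vs \<le> \<beta>" "\<beta> < 0"
  shows "\<exists>\<delta>>0. \<exists>\<Upsilon>>0. \<forall>k\<ge>3.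
    iterates_close x xs \<delta> k \<longrightarrow> x k \<noteq> xs \<longrightarrow>
    robustly_nondegenerate \<gamma> \<epsilon> P (Q k) xs zs \<mu>s \<longrightarrow>
    max_product (cball xs \<nu>x) (uV k) (\<lambda>x'. V k *\<^sub>v vV k x') \<le> \<beta> \<longrightarrow>
      \<bar>x (k + 1) - xs\<bar> / (\<bar>x k - xs\<bar> * max \<bar>x k - xs\<bar> \<bar>x (k - 1) - xs\<bar>) \<le> \<Upsilon>"
proof -
  have A: "A x' \<in> carrier_mat n n" for x'
    by (simp add: A_def matrix_family_def)
  obtain M where M: "0 < M"
    "\<And>P y. analytic_branch \<gamma> \<epsilon> C P xs zs \<mu>s \<nu>x \<nu>z \<nu>\<mu> y \<Longrightarrow> \<exists>a1 a2 a3. \<forall>x\<in>ball xs \<nu>x.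
      ((\<lambda>x. Re (fst (y x))) has_real_derivative a1 x) (at x) \<and>
      (a1 has_real_derivative a2 x) (at x) \<and> (a2 has_real_derivative a3 x) (at x) \<and> \<bar>a3 x\<bar> \<le> M"
    using analytic_branch_third_derivative[OF \<gamma> radii(1,2)] by blast

  \<comment> \<open>Full and reduced abscissae and their derivatives on the ball\<close>
  define \<alpha> where "\<alpha> x' = pseudo_abscissa \<epsilon> (P x')" for x'
  define \<alpha>V where "\<alpha>V k x' = pseudo_abscissa \<epsilon> (Q k x')" for k x'
  have ball: "ball xs \<nu>x \<subseteq> cball xs \<nu>x" "xs \<in> ball xs \<nu>x" "ball xs \<nu>x \<subseteq> D"
    using radii by auto
  have derivs: "\<exists>a1 a2 a3. \<forall>t\<in>ball xs \<nu>x. (F has_real_derivative a1 t) (at t) \<and>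
      (a1 has_real_derivative a2 t) (at t) \<and> (a2 has_real_derivative a3 t) (at t) \<and> \<bar>a3 t\<bar> \<le> M"
    if br: "analytic_branch \<gamma> \<epsilon> C R xs zs \<mu>s \<nu>x \<nu>z \<nu>\<mu> w"
      and F: "F = (\<lambda>t. pseudo_abscissa \<epsilon> (R t))" for R w F
  proof -
    have eq: "Re (fst (w t)) = F t" if "t \<in> ball xs \<nu>x" for t
      using br that ball(1) by (auto simp: analytic_branch_def F)
    have "(F has_real_derivative d) (at t)"
      if "t \<in> ball xs \<nu>x" "((\<lambda>t. Re (fst (w t))) has_real_derivative d) (at t)" for t d
      by (rule has_field_derivative_transform_within_open[OF that(2) open_ball that(1) eq])
    then show ?thesis
      using M(2)[OF br] by blast
  qed
  obtain a1 a2 a3 where a: "\<And>t. t \<in> ball xs \<nu>x \<Longrightarrow> (\<alpha> has_real_derivative a1 t) (at t)"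
    "\<And>t. t \<in> ball xs \<nu>x \<Longrightarrow> (a1 has_real_derivative a2 t) (at t)"
    "\<And>t. t \<in> ball xs \<nu>x \<Longrightarrow> (a2 has_real_derivative a3 t) (at t)"
    "\<And>t. t \<in> ball xs \<nu>x \<Longrightarrow> \<bar>a3 t\<bar> \<le> M"
    using derivs[OF full_branch(1), of \<alpha>] unfolding \<alpha>_def by blast
  have crit: "a1 xs = 0"
  proof (rule local_min_derivative_zero[OF a(1)[OF ball(2)] ball(2)])
    fix s assume "s \<in> ball xs \<nu>x"
    then have "s \<in> \<Omega>"
      using ball(3) D(1) by blast
    then show "\<alpha> xs \<le> \<alpha> s"
      using minimizer(2) by (simp add: \<alpha>_def)
  qed
  have "(deriv ^^ 2) \<alpha> xs = a2 xs"
  proof -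
    have "(deriv \<alpha> has_real_derivative a2 xs) (at xs)"
      using DERIV_imp_deriv[OF a(1)]
      by (intro has_field_derivative_transform_within_open[OF a(2) open_ball, OF ball(2) ball(2)]) auto
    then show ?thesis
      by (simp add: numeral_2_eq_2 DERIV_imp_deriv)
  qed
  then have c: "0 < \<bar>a2 xs\<bar>"
    using second_derivative by (simp add: \<alpha>_def[abs_def])
  \<comment> \<open>\<open>\<delta>0\<close> makes the reduced branch available,
    \<open>\<nu>x / 2\<close> keeps the iterates strictly inside the ball, and the last term is the
    absorption condition of the quasi-Newton estimate.\<close>
  define \<delta> where "\<delta> = min \<delta>0 (min (\<nu>x / 2) (\<bar>a2 xs\<bar> / (14 * M)))"
  have \<delta>: "0 < \<delta>" "\<delta> \<le> \<delta>0" "\<delta> < \<nu>x" "14 * M * \<delta> \<le> \<bar>a2 xs\<bar>"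
  proof -
    show "0 < \<delta>" "\<delta> \<le> \<delta>0" "\<delta> < \<nu>x"
      using radii c M(1) by (auto simp: \<delta>_def)
    have "\<delta> \<le> \<bar>a2 xs\<bar> / (14 * M)"
      by (simp add: \<delta>_def)
    then show "14 * M * \<delta> \<le> \<bar>a2 xs\<bar>"
      using M(1) by (simp add: field_simps)
  qed
  \<comment> \<open>Nonemptiness at the first subspace passes to all later ones by nestedness, so
    each reduced \<open>Sup\<close> is taken over a nonempty set.\<close>
  have le: "\<alpha>V j x' \<le> \<alpha> x'" if "x' \<in> D" "1 \<le> j" for j x'
  proof -
    have "pseudospectrum \<epsilon> (Q j x') \<noteq> {}"
      using run_pseudospectrum_mono[OF run A le_refl that(2), of x'] nonempty that(1)
      unfolding Q_def by blast
    then show ?thesis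
      using run_pseudospectrum_subset_full[OF run A that(2), of x']
      unfolding \<alpha>V_def \<alpha>_def P_def Q_def
      by (intro pseudo_abscissa_le_full[where A = A and x = x', OF A n \<epsilon>])
  qed
  have run_step: "x j \<in> D" "\<And>x'. x' \<in> D \<Longrightarrow> \<alpha>V (j - 1) (x j) \<le> \<alpha>V (j - 1) x'"
    "rightmost_point \<epsilon> (P (x j)) (z j)" if "2 \<le> j" for j
    using run that unfolding subspace_framework_def \<alpha>V_def Q_def P_def by blast+
  \<comment> \<open>For the lower bound, the rightmost point \<open>z j\<close> of the full problem
    belongs to the reduced pseudospectrum at \<open>x j\<close>.\<close>
  have interp: "\<alpha>V k (x j) = \<alpha> (x j)" if "2 \<le> j" "j \<le> k" for j k
  proof (rule antisym)
    show "\<alpha>V k (x j) \<le> \<alpha> (x j)"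
      using le run_step(1) that by simp
    have "\<alpha> (x j) = Re (z j)"
      unfolding \<alpha>_def by (rule rightmost_point_abscissa[OF run_step(3)[OF that(1)]])
    also have "\<dots> \<le> \<alpha>V k (x j)"
      unfolding \<alpha>V_def pseudo_abscissa_def Q_def
      using run_interpolation[OF run A n that] run_pseudospectrum_subset_full[OF run A, of k] that
      by (intro Re_le_pseudo_abscissa[where A = A and x = "x j", OF A n \<epsilon>]) auto
    finally show "\<alpha> (x j) \<le> \<alpha>V k (x j)" .
  qed

  \<comment> \<open>The estimate for a single step\<close>
  have "\<bar>x (k + 1) - xs\<bar> / (\<bar>x k - xs\<bar> * max \<bar>x k - xs\<bar> \<bar>x (k - 1) - xs\<bar>) \<le> 8 * M / \<bar>a2 xs\<bar>"
    if k: "3 \<le> k" and close: "iterates_close x xs \<delta> k" and ne: "x k \<noteq> xs"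
      and R: "robustly_nondegenerate \<gamma> \<epsilon> P (Q k) xs zs \<mu>s" for k
  proof -
    have near: "\<bar>x (k + 1) - xs\<bar> \<le> \<delta>" "\<bar>x k - xs\<bar> \<le> \<delta>" "\<bar>x (k - 1) - xs\<bar> \<le> \<delta>"
      using close by (auto simp: iterates_close_def)
    then have inb: "x (k + 1) \<in> ball xs \<nu>x" "x k \<in> ball xs \<nu>x" "x (k - 1) \<in> ball xs \<nu>x"
      using \<delta>(3) by (auto simp: dist_real_def)
    have "iterates_close x xs \<delta>0 k"
      using close \<delta>(2) unfolding iterates_close_def by (meson order_trans)
    then have "analytic_branch \<gamma> \<epsilon> C (Q k) xs zs \<mu>s \<nu>x \<nu>z \<nu>\<mu> (yV k)"
      using reduced_branch k R by blast
    from derivs[OF this, of "\<alpha>V k"]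
    obtain b1 b2 b3 where b: "\<And>t. t \<in> ball xs \<nu>x \<Longrightarrow> (\<alpha>V k has_real_derivative b1 t) (at t)"
      "\<And>t. t \<in> ball xs \<nu>x \<Longrightarrow> (b1 has_real_derivative b2 t) (at t)"
      "\<And>t. t \<in> ball xs \<nu>x \<Longrightarrow> (b2 has_real_derivative b3 t) (at t)"
      "\<And>t. t \<in> ball xs \<nu>x \<Longrightarrow> \<bar>b3 t\<bar> \<le> M"
      unfolding \<alpha>V_def by blast
    \<comment> \<open>On the ball \<open>\<alpha> - \<alpha>V k\<close> is nonnegative and vanishes
      at \<open>x j\<close>, so this is an interior minimum.\<close>
    have hermite: "a1 (x j) = b1 (x j)" if "2 \<le> j" "j \<le> k" "x j \<in> ball xs \<nu>x" for j
    proof -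
      have "a1 (x j) - b1 (x j) = 0"
      proof (rule local_min_derivative_zero[OF _ that(3)])
        show "((\<lambda>t. \<alpha> t - \<alpha>V k t) has_real_derivative a1 (x j) - b1 (x j)) (at (x j))"
          by (intro DERIV_diff a(1) b(1) that(3))
        fix s assume "s \<in> ball xs \<nu>x"
        then show "\<alpha> (x j) - \<alpha>V k (x j) \<le> \<alpha> s - \<alpha>V k s"
          using interp[OF that(1,2)] le[of s k] ball(3) k by auto
      qed
      then show ?thesis by simp
    qed
    \<comment> \<open>\<open>x (k + 1)\<close> minimizes \<open>\<alpha>V k\<close> over
      \<open>D\<close>, which contains the ball.\<close>
    have next_crit: "b1 (x (k + 1)) = 0"
      using run_step(2)[of "k + 1"] k ball(3)
      by (intro local_min_derivative_zero[OF b(1)[OF inb(1)] inb(1)]) auto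
    have distinct: "x k \<noteq> x (k - 1)"
    proof
      assume same: "x k = x (k - 1)"
      have "\<alpha> (x k) \<le> \<alpha> s" if "s \<in> ball xs \<nu>x" for s
      proof -
        have s: "s \<in> D"
          using that ball(3) by blast
        \<comment> \<open>Interpolation in the subspace of step \<open>k - 1\<close> is available at
          \<open>x (k - 1) = x k\<close>, because \<open>k \<ge> 3\<close> gives
          \<open>k - 1 \<ge> 2\<close>. The same reduced function is the one minimized by
          \<open>x k\<close>.\<close>
        have "\<alpha> (x k) = \<alpha>V (k - 1) (x k)"
          using interp[of "k - 1" "k - 1"] k same by simp
        also have "\<dots> \<le> \<alpha>V (k - 1) s"
          using k by (intro run_step(2) s) simp
        also have "\<dots> \<le> \<alpha> s"
          using k by (intro le s) simp
        finally show ?thesis .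
      qed
      then have "a1 (x k) = 0"
        by (rule local_min_derivative_zero[OF a(1)[OF inb(2)] inb(2)])
      \<comment> \<open>Two distinct critical points \<open>xs\<close> and \<open>x k\<close> force
        a zero of \<open>a2\<close> within \<open>\<delta>\<close> of \<open>xs\<close>. Over that
        distance \<open>a2\<close> changes by at most \<open>M * \<delta>\<close>, whereas
        \<open>\<bar>a2 xs\<bar>\<close> is at least \<open>14 * M * \<delta>\<close>.\<close>
      then obtain \<xi> where \<xi>: "\<xi> \<in> ball xs \<nu>x" "\<bar>\<xi> - xs\<bar> \<le> \<delta>" "a2 \<xi> = 0"
        using mvt_real[OF a(2) ball(2) inb(2)] crit ne near(2)
        by (metis abs_ge_zero abs_zero diff_self max.absorb2 mult_eq_0_iff order_trans right_minus_eq)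
      obtain \<zeta> where "\<zeta> \<in> ball xs \<nu>x" "a2 \<xi> - a2 xs = a3 \<zeta> * (\<xi> - xs)"
        using mvt_real[OF a(3) ball(2) \<xi>(1)] by metis
      then have "\<bar>a2 xs\<bar> = \<bar>a3 \<zeta>\<bar> * \<bar>\<xi> - xs\<bar>" "\<bar>a3 \<zeta>\<bar> \<le> M"
        using \<xi>(3) a(4) by (auto simp flip: abs_mult)
      then have "\<bar>a2 xs\<bar> \<le> M * \<delta>"
        using \<xi>(2) by (auto intro: mult_mono)
      moreover have "0 < M * \<delta>"
        using M(1) \<delta>(1) by simp
      ultimately show False
        using \<delta>(4) by linarith
    qed
    \<comment> \<open>The roles are \<open>c = xs\<close>, \<open>p = x (k + 1)\<close>,
      \<open>q = x k\<close>, \<open>r = x (k - 1)\<close>; agreement of the derivatives at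
      \<open>r\<close> again uses \<open>k - 1 \<ge> 2\<close>.\<close>
    have "\<bar>a2 xs\<bar> * \<bar>x (k + 1) - xs\<bar> \<le> 8 * M * (\<bar>x k - xs\<bar> * max \<bar>x k - xs\<bar> \<bar>x (k - 1) - xs\<bar>)"
      using k
      by (intro secant_newton_step[OF a(2-4) b(2-4) crit next_crit hermite[OF _ _ inb(2)]
            hermite[OF _ _ inb(3)] distinct near \<delta>(3) M(1) \<delta>(4)]) auto
    moreover have "0 < \<bar>x k - xs\<bar> * max \<bar>x k - xs\<bar> \<bar>x (k - 1) - xs\<bar>"
      using ne by (simp add: less_max_iff_disj)
    ultimately show ?thesis
      using c by (simp add: divide_simps mult_ac)
  qed
  moreover have "0 < 8 * M / \<bar>a2 xs\<bar>"
    using c M(1) by simp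
  ultimately show ?thesis
    using \<delta>(1) by blast
qed

end
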